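(* Let $|G\rangle$ be the weighted graph state of a weighted graph $G=(V,E,\Theta)$ on $n$ vertices, let $\mathscr{A}=\{A_1,\dots,A_m\}$ be an independence cover of $V$, let $h\ge1$ and $N\ge1$ be integers, and let $\beta\in(0,1]$ satisfy $\beta\ge\frac1{N+1}$. Let $\bar\Omega_h(\mathscr{A})=\frac1m\sum_{l=1}^m\bar P_{l;h}$ be the test operator defined in the context. Then: (1) the state $|G\rangle^{\otimes(N+1)}$ passes the $N$-random sampling test of $\bar\Omega_h(\mathscr{A})$ with probability at least $\left(1-\frac1h\sin^2\frac{\pi}{4h}\right)^{N\max_l|A_l|}$; (2) when the $N$-random sampling test of $\bar\Omega_h(\mathscr{A})$ is passed, the resultant state $\sigma$ satisfies, with significance level $\beta$, $$\langle G|\sigma|G\rangle\ \ge\ 1-\left[\frac{mh(1-\beta)}{\beta N}+n\sin\frac{\pi}{4h}\right].$$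
   Context: **Weighted graph states.** A weighted graph $G=(V,E,\Theta)$ consists of a finite vertex set $V=[n]=\{1,\dots,n\}$, a set $E$ of edges, and real weights $\Theta=\{\theta_{jk}\}_{j<k}$, with $\theta_{jk}=0$ if $(j,k)\notin E$; put $\theta_{kj}=\theta_{jk}$. One qubit $\mathbb{C}^2$ is placed on each vertex. With $|+\rangle=(|0\rangle+|1\rangle)/\sqrt2$ and $\Lambda_{jk}(\theta)=|0\rangle\langle 0|_j\otimes I_k+|1\rangle\langle 1|_j\otimes(|0\rangle\langle 0|_k+e^{i\theta}|1\rangle\langle1|_k)$, the weighted graph state is $|G\rangle=\big[\prod_{(j,k)\in E}\Lambda_{jk}(\theta_{jk})\big]|+\rangle^{\otimes n}$. **Independence cover.** A subset of $V$ is independent if no two of its vertices are joined by an edge. An independence cover $\mathscr{A}=\{A_1,\dots,A_m\}$ is a set of independent sets with $\bigcup_l A_l=V$; throughout, the $A_l$ are nonempty and pairwise disjoint. $A_l^c=V\setminus A_l$, and $|A_l|$ is the number of elements of $A_l$. **Test operator.** For real $\alpha$ put $|\alpha\rangle=\frac1{\sqrt2}(|0\rangle+e^{i\alpha}|1\rangle)$. For $k\in A_l$, let $C_k\subset A_l^c$ be the set of neighbours of $k$, and for $\mathbf z=(z_j)_{j\in A_l^c}\in\{0,1\}^{A_l^c}$ put $\alpha_k(\mathbf z)=\sum_{j\in C_k}\theta_{jk}z_j$. Let $\alpha_k^h(\mathbf z)=\frac{t\pi}{h}$, where $t$ is the unique integer with $\frac{t\pi}{h}-\frac{\pi}{2h}\le\alpha_k(\mathbf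 z)<\frac{t\pi}{h}+\frac{\pi}{2h}$. Define $$Q_{k;h}=\sum_{\mathbf z\in\{0,1\}^{A_l^c}}|\alpha_k^h(\mathbf z)\rangle\langle\alpha_k^h(\mathbf z)|_k\otimes|\mathbf z\rangle\langle\mathbf z|_{A_l^c}$$ (acting as the identity on $A_l\setminus\{k\}$), and $$\bar P_{l;h}=\prod_{k\in A_l}\left(\frac1hQ_{k;h}+\frac{h-1}{h}I\right),\qquad \bar\Omega_h(\mathscr{A})=\frac1m\sum_{l=1}^m\bar P_{l;h}.$$ **$N$-random sampling test of an operator $0\le\Omega\le I$.** Let $\rho$ be an arbitrary state (no i.i.d. assumption) on $N+1$ copies of the $n$-qubit system. Choose $N$ of the $N+1$ copies uniformly at random, apply the two-outcome POVM $\{\Omega,I-\Omega\}$ to each of them, and accept (the test is passed) iff all $N$ outcomes correspond to $\Omega$. When the test is passed, the resultant state $\sigma$ is the state of the remaining copy conditional on acceptance. Explicitly, writing $\Omega^{(i)}$ for the operator acting as $\Omega$ on every copy except the $i$-th and as $I$ on the $i$-th, the passing probability is $p(\rho)=\frac1{N+1}\sum_{i=1}^{N+1}\mathrm{Tr}[\Omega^{(i)}\rho]$, and $\mathrm{Tr}[\sigma X]=\frac{1}{p(\rho)(N+1)}\sum_{i=1}^{N+1}\mathrm{Tr}[\Omega^{(i)}X_i\,\rho]$ for every operator $X$ on a single copy, where $X_i$ is $X$ acting on the $i$-th copy. **Significance level.** A statement about $\sigma$ holds "with significance level $\beta$" if it holds for every $\rho$ with passing probability $p(\rho)\ge\beta$.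 *)

theory Defs
  imports "HOL-Analysis.Analysis"
begin

text \<open>
  A register whose sites form the finite type \<open>'i\<close>, each site carrying the space with orthonormal
  basis \<open>'b\<close>, has the basis \<open>'i \<Rightarrow> 'b\<close>.  This is used twice: for qubits (\<open>'b = bool\<close>) sitting on
  the vertices \<open>'v\<close> of a graph, and for copies \<open>'c\<close> of the resulting system
  (\<open>'b = 'v \<Rightarrow> bool\<close>).
\<close>

type_synonym 'b cvec = "complex ^ 'b"
type_synonym 'b cmat = "complex ^ 'b ^ 'b"

definition cinner :: "'b::finite cvec \<Rightarrow> 'b cvec \<Rightarrow> complex" where
  "cinner v w = (\<Sum>i\<in>UNIV. cnj (v $ i) * w $ i)"

definition ketbra :: "'b::finite cvec \<Rightarrow> 'b cvec \<Rightarrow> 'b cmat" where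
  "ketbra v w = (\<chi> i j. v $ i * cnj (w $ j))"

abbreviation proj :: "'b::finite cvec \<Rightarrow> 'b cmat" where
  "proj v \<equiv> ketbra v v"

definition density_op :: "'b::finite cmat \<Rightarrow> bool" where
  "density_op \<rho> \<longleftrightarrow> (\<forall>i j. \<rho> $ i $ j = cnj (\<rho> $ j $ i)) \<and> (\<forall>v. 0 \<le> Re (cinner v (\<rho> *v v))) \<and> trace \<rho> = 1"

definition tensor_vec :: "('i::finite \<Rightarrow> 'b::finite cvec) \<Rightarrow> ('i \<Rightarrow> 'b) cvec" where
  "tensor_vec v = (\<chi> b. \<Prod>i\<in>UNIV. v i $ b i)"

definition tensor_op :: "('i::finite \<Rightarrow> 'b::finite cmat) \<Rightarrow> ('i \<Rightarrow> 'b) cmat" where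
  "tensor_op A = (\<chi> b b'. \<Prod>i\<in>UNIV. A i $ b i $ b' i)"

definition op_at :: "'i::finite \<Rightarrow> 'b::finite cmat \<Rightarrow> ('i \<Rightarrow> 'b) cmat" where
  "op_at i X = tensor_op ((\<lambda>_. mat 1)(i := X))"

text \<open>
  Operator product over a finite set; it is only used for commuting factors, see
  \<open>op_prod_insert\<close>, \<open>cphase_commute\<close> and \<open>test_factor_commute\<close> below.
\<close>

definition op_prod :: "('a \<Rightarrow> 'b::finite cmat) \<Rightarrow> 'a set \<Rightarrow> 'b cmat" where
  "op_prod f S = Finite_Set.fold (\<lambda>x A. f x ** A) (mat 1) S"


subsection \<open>Weighted graph states\<close>

text \<open>The basis label \<open>False\<close> stands for 0 and \<open>True\<close> for 1.\<close>

definition ket :: "bool \<Rightarrow> bool cvec" where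
  "ket b = axis b 1"

definition ket_plus :: "bool cvec" where
  "ket_plus = (1 / sqrt 2) *\<^sub>R (ket False + ket True)"

definition ket_angle :: "real \<Rightarrow> bool cvec" where
  "ket_angle \<alpha> = (1 / sqrt 2) *\<^sub>R (ket False + cis \<alpha> *s ket True)"

text \<open>
  An edge is stored as the pair \<open>(j, k)\<close> with \<open>j < k\<close>; the weight is extended symmetrically to all
  pairs.
\<close>

definition weighted_graph :: "('v::{finite,linorder} \<times> 'v) set \<Rightarrow> ('v \<Rightarrow> 'v \<Rightarrow> real) \<Rightarrow> bool" where
  "weighted_graph E \<theta> \<longleftrightarrow>
     (\<forall>j k. (j, k) \<in> E \<longrightarrow> j < k) \<and>
     (\<forall>j k. \<theta> k j = \<theta> j k) \<and>
     (\<forall>j k. j < k \<longrightarrow> (j, k) \<notin> E \<longrightarrow> \<theta> j k = 0)"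

definition nbrs :: "('v \<times> 'v) set \<Rightarrow> 'v \<Rightarrow> 'v set" where
  "nbrs E k = {j. (j, k) \<in> E \<or> (k, j) \<in> E}"

definition cphase :: "real \<Rightarrow> 'v::finite \<Rightarrow> 'v \<Rightarrow> ('v \<Rightarrow> bool) cmat" where
  "cphase t j k =
     tensor_op ((\<lambda>_. mat 1)(j := proj (ket False))) +
     tensor_op ((\<lambda>_. mat 1)(j := proj (ket True),
                            k := proj (ket False) + ketbra (cis t *s ket True) (ket True)))"

definition graph_state :: "('v::{finite,linorder} \<times> 'v) set \<Rightarrow> ('v \<Rightarrow> 'v \<Rightarrow> real) \<Rightarrow> ('v \<Rightarrow> bool) cvec" where
  "graph_state E \<theta> = op_prod (\<lambda>(j, k). cphase (\<theta> j k) j k) E *v tensor_vec (\<lambda>_. ket_plus)"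


subsection \<open>Test operators\<close>

definition independent_set :: "('v \<times> 'v) set \<Rightarrow> 'v set \<Rightarrow> bool" where
  "independent_set E A \<longleftrightarrow> (\<forall>j\<in>A. \<forall>k\<in>A. (j, k) \<notin> E)"

definition independence_cover :: "('v \<times> 'v) set \<Rightarrow> 'v set set \<Rightarrow> bool" where
  "independence_cover E \<A> \<longleftrightarrow>
     (\<forall>A\<in>\<A>. independent_set E A \<and> A \<noteq> {}) \<and> pairwise disjnt \<A> \<and> \<Union>\<A> = UNIV"

definition angle :: "('v \<times> 'v) set \<Rightarrow> ('v \<Rightarrow> 'v \<Rightarrow> real) \<Rightarrow> 'v::finite \<Rightarrow> ('v \<Rightarrow> bool) \<Rightarrow> real" where
  "angle E \<theta> k z = (\<Sum>j\<in>nbrs E k. \<theta> j k * of_bool (z j))"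

definition round_angle :: "nat \<Rightarrow> real \<Rightarrow> real" where
  "round_angle h \<alpha> =
     of_int (THE t::int. of_int t * pi / real h - pi / (2 * real h) \<le> \<alpha> \<and>
                         \<alpha> < of_int t * pi / real h + pi / (2 * real h)) * pi / real h"

text \<open>
  In \<open>test_Q E \<theta> h A k\<close> the bit strings indexed by the complement of \<open>A\<close> are the functions in
  \<open>- A \<rightarrow>\<^sub>E UNIV\<close>, whose value on \<open>A\<close> is the fixed element \<open>undefined\<close>.
  That value is never used: \<open>nbrs E k \<subseteq> - A\<close> when \<open>A\<close> is independent and \<open>k \<in> A\<close>.
\<close>

definition test_Q ::
    "('v \<times> 'v) set \<Rightarrow> ('v \<Rightarrow> 'v \<Rightarrow> real) \<Rightarrow> nat \<Rightarrow> 'v set \<Rightarrow> 'v::finite \<Rightarrow> ('v \<Rightarrow> bool) cmat" where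
  "test_Q E \<theta> h A k =
     (\<Sum>z \<in> (- A) \<rightarrow>\<^sub>E (UNIV :: bool set).
        tensor_op (\<lambda>j. if j = k then proj (ket_angle (round_angle h (angle E \<theta> k z)))
                       else if j \<in> - A then proj (ket (z j))
                       else mat 1))"

definition test_factor ::
    "('v \<times> 'v) set \<Rightarrow> ('v \<Rightarrow> 'v \<Rightarrow> real) \<Rightarrow> nat \<Rightarrow> 'v set \<Rightarrow> 'v::finite \<Rightarrow> ('v \<Rightarrow> bool) cmat" where
  "test_factor E \<theta> h A k =
     (1 / real h) *\<^sub>R test_Q E \<theta> h A k + ((real h - 1) / real h) *\<^sub>R mat 1"

definition test_P ::
    "('v \<times> 'v) set \<Rightarrow> ('v \<Rightarrow> 'v \<Rightarrow> real) \<Rightarrow> nat \<Rightarrow> 'v::finite set \<Rightarrow> ('v \<Rightarrow> bool) cmat" where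
  "test_P E \<theta> h A = op_prod (test_factor E \<theta> h A) A"

definition test_Omega ::
    "('v \<times> 'v) set \<Rightarrow> ('v \<Rightarrow> 'v \<Rightarrow> real) \<Rightarrow> nat \<Rightarrow> 'v::finite set set \<Rightarrow> ('v \<Rightarrow> bool) cmat" where
  "test_Omega E \<theta> h \<A> = (1 / real (card \<A>)) *\<^sub>R (\<Sum>A\<in>\<A>. test_P E \<theta> h A)"


subsection \<open>Random sampling tests\<close>

text \<open>
  The copies are the elements of \<open>'c\<close>, so \<open>CARD('c)\<close> is the total number \<open>N + 1\<close> of copies.
  The traces in \<open>pass_prob\<close> are real whenever \<open>\<Omega>\<close> is positive semidefinite and \<open>\<rho>\<close> is a density
  operator; \<open>Re\<close> only adjusts the type.
\<close>

definition tested_except :: "'b::finite cmat \<Rightarrow> 'c::finite \<Rightarrow> ('c \<Rightarrow> 'b) cmat" where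
  "tested_except \<Omega> i = tensor_op ((\<lambda>_. \<Omega>)(i := mat 1))"

definition pass_prob :: "'b::finite cmat \<Rightarrow> ('c::finite \<Rightarrow> 'b) cmat \<Rightarrow> real" where
  "pass_prob \<Omega> \<rho> = (1 / real CARD('c)) * (\<Sum>i\<in>UNIV. Re (trace (tested_except \<Omega> i ** \<rho>)))"

text \<open>
  \<open>resultant_state \<Omega> \<rho> \<sigma>\<close>: \<open>\<sigma>\<close> is the state of the remaining copy conditional on acceptance.
  It is unique by \<open>ex1_resultant_state\<close>.
\<close>

definition resultant_state :: "'b::finite cmat \<Rightarrow> ('c::finite \<Rightarrow> 'b) cmat \<Rightarrow> 'b cmat \<Rightarrow> bool" where
  "resultant_state \<Omega> \<rho> \<sigma> \<longleftrightarrow>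
     (\<forall>X. trace (\<sigma> ** X) =
        complex_of_real (1 / (pass_prob \<Omega> \<rho> * real CARD('c))) *
          (\<Sum>i\<in>UNIV. trace (tested_except \<Omega> i ** op_at i X ** \<rho>)))"


subsection \<open>Well-definedness\<close>

lemma ex1_round:
  assumes "h \<ge> 1"
  shows "\<exists>!t::int. of_int t * pi / real h - pi / (2 * real h) \<le> \<alpha> \<and>
                   \<alpha> < of_int t * pi / real h + pi / (2 * real h)"
proof -
  have h: "real h > 0" using assms by simp
  have lo: "of_int t * pi / real h - pi / (2 * real h) \<le> \<alpha> \<longleftrightarrow> of_int t \<le> \<alpha> * real h / pi + 1/2"
    for t :: int using h pi_gt_zero by (simp add: field_simps)
  have hi: "\<alpha> < of_int t * pi / real h + pi / (2 * real h) \<longleftrightarrow> \<alpha> * real h / pi + 1/2 < of_int t + 1"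
    for t :: int using h pi_gt_zero by (simp add: field_simps)
  show ?thesis
    unfolding lo hi
  proof (rule ex1I[of _ "\<lfloor>\<alpha> * real h / pi + 1/2\<rfloor>"])
    show "of_int \<lfloor>\<alpha> * real h / pi + 1/2\<rfloor> \<le> \<alpha> * real h / pi + 1/2 \<and>
          \<alpha> * real h / pi + 1/2 < of_int \<lfloor>\<alpha> * real h / pi + 1/2\<rfloor> + 1"
      by linarith
  qed (use floor_unique in auto)
qed

lemma scaleR_matrix_mult:
  fixes A B :: "'b::finite cmat"
  shows "(r *\<^sub>R A) ** B = r *\<^sub>R (A ** B)" "A ** (r *\<^sub>R B) = r *\<^sub>R (A ** B)"
  by (simp_all add: matrix_matrix_mult_def vec_eq_iff scaleR_sum_right)

lemma matrix_mult_add: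
  fixes A B C :: "'b::finite cmat"
  shows "(A + B) ** C = A ** C + B ** C" "A ** (B + C) = A ** B + A ** C"
  by (simp_all add: matrix_matrix_mult_def vec_eq_iff sum.distrib algebra_simps)

lemma matrix_mult_sum:
  fixes B :: "'b::finite cmat"
  shows "(\<Sum>x\<in>S. f x) ** B = (\<Sum>x\<in>S. f x ** B)" "B ** (\<Sum>x\<in>S. f x) = (\<Sum>x\<in>S. B ** f x)"
  by (induction S rule: infinite_finite_induct)
     (auto simp: matrix_mult_add)

lemma tensor_op_mult: "tensor_op A ** tensor_op B = tensor_op (\<lambda>i. A i ** B i)"
proof -
  have "(\<Sum>g\<in>UNIV. (\<Prod>i\<in>UNIV. A i $ b i $ g i) * (\<Prod>i\<in>UNIV. B i $ g i $ b' i)) =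
        (\<Prod>i\<in>UNIV. \<Sum>x\<in>UNIV. A i $ b i $ x * B i $ x $ b' i)" for b b'
    by (subst prod_sum_PiE) (auto simp: prod.distrib PiE_UNIV_domain)
  then show ?thesis
    by (simp add: tensor_op_def matrix_matrix_mult_def vec_eq_iff)
qed

lemma op_prod_empty: "op_prod f {} = mat 1"
  by (simp add: op_prod_def)

lemma op_prod_insert:
  assumes "finite S" "x \<notin> S"
    and "\<And>y z. y \<in> insert x S \<Longrightarrow> z \<in> insert x S \<Longrightarrow> f y ** f z = f z ** f y"
  shows "op_prod f (insert x S) = f x ** op_prod f S"
proof -
  interpret comp_fun_commute_on "insert x S" "\<lambda>x A. f x ** A"
    by standard (auto simp: fun_eq_iff matrix_mul_assoc assms(3))
  show ?thesis
    unfolding op_prod_def using assms by (intro fold_insert) auto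
qed

definition is_diag :: "'b::finite cmat \<Rightarrow> bool" where
  "is_diag A \<longleftrightarrow> (\<forall>i j. i \<noteq> j \<longrightarrow> A $ i $ j = 0)"

lemma is_diag_commute:
  assumes "is_diag A" "is_diag B"
  shows "A ** B = B ** A"
proof -
  have "(\<Sum>k\<in>UNIV. A $ i $ k * B $ k $ j) = (\<Sum>k\<in>UNIV. B $ i $ k * A $ k $ j)" for i j
  proof -
    have "A $ i $ k * B $ k $ j = B $ i $ k * A $ k $ j" for k
      using assms unfolding is_diag_def
      by (cases "i = k"; cases "k = j") auto
    then show ?thesis by simp
  qed
  then show ?thesis by (simp add: matrix_matrix_mult_def vec_eq_iff)
qed

lemma is_diag_tensor_op:
  assumes "\<And>i. is_diag (A i)"
  shows "is_diag (tensor_op A)"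
  using assms by (fastforce simp: is_diag_def tensor_op_def fun_eq_iff)

lemma is_diag_add: "is_diag A \<Longrightarrow> is_diag B \<Longrightarrow> is_diag (A + B)"
  by (auto simp: is_diag_def)

lemma is_diag_mat: "is_diag (mat c)"
  by (auto simp: is_diag_def mat_def)

lemma is_diag_ketbra_ket: "is_diag (ketbra (c *s ket b) (ket b))" "is_diag (proj (ket b))"
  by (auto simp: is_diag_def ketbra_def ket_def axis_def)

lemma is_diag_cphase: "is_diag (cphase t j k)"
  unfolding cphase_def
  by (intro is_diag_add is_diag_tensor_op)
     (auto intro!: is_diag_mat is_diag_ketbra_ket is_diag_add)

lemma cphase_commute: "cphase t j k ** cphase t' j' k' = cphase t' j' k' ** cphase t j k"
  by (intro is_diag_commute is_diag_cphase)

lemma test_Q_commute: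
  assumes "k \<in> A" "k' \<in> A"
  shows "test_Q E \<theta> h A k ** test_Q E \<theta> h A k' = test_Q E \<theta> h A k' ** test_Q E \<theta> h A k"
proof (cases "k = k'")
  case False
  define T where "T k z = tensor_op (\<lambda>j. if j = k then proj (ket_angle (round_angle h (angle E \<theta> k z)))
                       else if j \<in> - A then proj (ket (z j)) else mat 1)" for k z
  have T: "T k z ** T k' z' = T k' z' ** T k z" for z z'
    unfolding T_def tensor_op_mult
    using False assms
    by (intro arg_cong[where f = tensor_op] ext)
       (auto simp: is_diag_commute is_diag_ketbra_ket)
  show ?thesis
    unfolding test_Q_def T_def[symmetric]
    unfolding matrix_mult_sum
    by (subst sum.swap) (simp only: T)
qed simp

lemma test_factor_commute:
  assumes "k \<in> A" "k' \<in> A"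
  shows "test_factor E \<theta> h A k ** test_factor E \<theta> h A k' =
         test_factor E \<theta> h A k' ** test_factor E \<theta> h A k"
  unfolding test_factor_def
  by (simp add: matrix_mult_add scaleR_matrix_mult
      test_Q_commute[OF assms] scaleR_add_right ac_simps)

lemma trace_mult: "trace (A ** X) = (\<Sum>a\<in>UNIV. \<Sum>a'\<in>UNIV. A $ a $ a' * X $ a' $ a)"
  for A X :: "'b::finite cmat"
  by (simp add: trace_def matrix_matrix_mult_def)

lemma trace_mult_unit: "trace (A ** ketbra (axis a' 1) (axis a 1)) = A $ a $ a'"
  for A :: "'b::finite cmat"
proof -
  have "A $ i $ j * ketbra (axis a' 1) (axis a 1) $ j $ i =
        (if i = a then (if j = a' then A $ i $ j else 0) else 0)" for i j
    by (auto simp: ketbra_def axis_def)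
  then have "trace (A ** ketbra (axis a' 1) (axis a 1)) =
      (\<Sum>i\<in>UNIV. \<Sum>j\<in>UNIV. if i = a then (if j = a' then A $ i $ j else 0) else 0)"
    by (simp only: trace_mult)
  also have "\<dots> = (\<Sum>i\<in>UNIV. if i = a then A $ i $ a' else 0)"
    by (intro sum.cong refl) auto
  finally show ?thesis by simp
qed

lemma trace_eq_iff:
  fixes A B :: "'b::finite cmat"
  shows "(\<forall>X. trace (A ** X) = trace (B ** X)) \<longleftrightarrow> A = B"
proof
  assume "\<forall>X. trace (A ** X) = trace (B ** X)"
  then have "A $ a $ a' = B $ a $ a'" for a a'
    using trace_mult_unit[of A a' a] trace_mult_unit[of B a' a] by simp
  then show "A = B" by (simp add: vec_eq_iff)
qed simp

lemma sum_swap3: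
  "(\<Sum>a\<in>A. \<Sum>b\<in>B. \<Sum>c\<in>C. f a b c) = (\<Sum>c\<in>C. \<Sum>a\<in>A. \<Sum>b\<in>B. f a b c)"
proof -
  have "(\<Sum>a\<in>A. \<Sum>b\<in>B. \<Sum>c\<in>C. f a b c) = (\<Sum>a\<in>A. \<Sum>c\<in>C. \<Sum>b\<in>B. f a b c)"
    by (intro sum.cong refl sum.swap)
  also have "\<dots> = (\<Sum>c\<in>C. \<Sum>a\<in>A. \<Sum>b\<in>B. f a b c)"
    by (rule sum.swap)
  finally show ?thesis .
qed

lemma partial_trace_exists:
  fixes M :: "('c::finite \<Rightarrow> 'b::finite) cmat"
  shows "\<exists>\<tau>. \<forall>X. trace (\<tau> ** X) = trace (M ** op_at i X)"
proof -
  define D where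
    "D b b' = (\<Prod>j\<in>UNIV - {i}. (mat 1 :: 'b cmat) $ b j $ b' j)" for b b' :: "'c \<Rightarrow> 'b"
  define K where "K b b' = M $ b $ b' * D b' b" for b b' :: "'c \<Rightarrow> 'b"
  define \<tau> :: "'b cmat" where
    "\<tau> = (\<chi> a a'. \<Sum>b\<in>UNIV. \<Sum>b'\<in>UNIV. if a = b i then (if a' = b' i then K b b' else 0) else 0)"
  have D: "op_at i X $ b $ b' = X $ b i $ b' i * D b b'" for X b b'
    unfolding op_at_def tensor_op_def D_def
    by (simp add: prod.remove[of UNIV i])
  have "trace (\<tau> ** X) = trace (M ** op_at i X)" for X
  proof -
    have "trace (\<tau> ** X) = (\<Sum>a\<in>UNIV. \<Sum>a'\<in>UNIV. \<Sum>b\<in>UNIV. \<Sum>b'\<in>UNIV.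
        if a = b i then (if a' = b' i then K b b' * X $ a' $ a else 0) else 0)"
      unfolding trace_mult \<tau>_def
      by (simp only: vec_lambda_beta sum_distrib_right, intro sum.cong refl) auto
    also have "\<dots> = (\<Sum>b\<in>UNIV. \<Sum>b'\<in>UNIV. \<Sum>a\<in>UNIV. \<Sum>a'\<in>UNIV.
        if a = b i then (if a' = b' i then K b b' * X $ a' $ a else 0) else 0)"
      by (subst sum_swap3, intro sum.cong refl sum_swap3)
    also have "\<dots> = (\<Sum>b\<in>UNIV. \<Sum>b'\<in>UNIV. \<Sum>a\<in>UNIV. if a = b i then K b b' * X $ b' i $ a else 0)"
      by (intro sum.cong refl) auto
    also have "\<dots> = (\<Sum>b\<in>UNIV. \<Sum>b'\<in>UNIV. K b b' * X $ b' i $ b i)"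
      by simp
    also have "\<dots> = trace (M ** op_at i X)"
      unfolding trace_mult D K_def by (simp add: ac_simps)
    finally show ?thesis .
  qed
  then show ?thesis by (intro exI allI)
qed

lemma ex1_resultant_state:
  fixes \<Omega> :: "'b::finite cmat" and \<rho> :: "('c::finite \<Rightarrow> 'b) cmat"
  shows "\<exists>!\<sigma>. resultant_state \<Omega> \<rho> \<sigma>"
proof -
  define \<tau> where
    "\<tau> i = (SOME \<tau>. \<forall>X. trace (\<tau> ** X) = trace ((\<rho> ** tested_except \<Omega> i) ** op_at i X))" for i
  have \<tau>: "trace (\<tau> i ** X) = trace ((\<rho> ** tested_except \<Omega> i) ** op_at i X)" for i X
    unfolding \<tau>_def
    using someI_ex[OF partial_trace_exists[of "\<rho> ** tested_except \<Omega> i" i]] by (rule spec)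
  define c where "c = complex_of_real (1 / (pass_prob \<Omega> \<rho> * real CARD('c)))"
  define \<sigma> :: "'b cmat" where "\<sigma> = (\<chi> a a'. c * (\<Sum>i\<in>UNIV. \<tau> i $ a $ a'))"
  have "trace (\<sigma> ** X) = c * (\<Sum>i\<in>UNIV. trace (tested_except \<Omega> i ** op_at i X ** \<rho>))" for X
  proof -
    have "trace (\<sigma> ** X) = (\<Sum>a\<in>UNIV. \<Sum>a'\<in>UNIV. \<Sum>i\<in>UNIV. c * (\<tau> i $ a $ a' * X $ a' $ a))"
      unfolding trace_mult \<sigma>_def by (simp add: sum_distrib_right sum_distrib_left mult.assoc)
    also have "\<dots> = (\<Sum>i\<in>UNIV. \<Sum>a\<in>UNIV. \<Sum>a'\<in>UNIV. c * (\<tau> i $ a $ a' * X $ a' $ a))"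
      by (rule sum_swap3)
    also have "\<dots> = c * (\<Sum>i\<in>UNIV. trace (\<tau> i ** X))"
      unfolding trace_mult by (simp add: sum_distrib_left)
    also have "(\<Sum>i\<in>UNIV. trace (\<tau> i ** X)) = (\<Sum>i\<in>UNIV. trace (tested_except \<Omega> i ** op_at i X ** \<rho>))"
    proof (intro sum.cong refl)
      fix i
      have "trace (\<tau> i ** X) = trace (\<rho> ** (tested_except \<Omega> i ** op_at i X))"
        by (simp only: \<tau> matrix_mul_assoc)
      also have "\<dots> = trace (tested_except \<Omega> i ** op_at i X ** \<rho>)"
        by (rule trace_mul_sym)
      finally show "trace (\<tau> i ** X) = trace (tested_except \<Omega> i ** op_at i X ** \<rho>)" .
    qed
    finally show ?thesis .
  qed
  then have ex: "resultant_state \<Omega> \<rho> \<sigma>"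
    unfolding resultant_state_def c_def by simp
  show ?thesis
  proof (rule ex1I)
    show "resultant_state \<Omega> \<rho> \<sigma>" by (rule ex)
  next
    fix \<sigma>' assume "resultant_state \<Omega> \<rho> \<sigma>'"
    then show "\<sigma>' = \<sigma>"
      using ex unfolding resultant_state_def by (simp flip: trace_eq_iff)
  qed
qed

end

theory Submission
  imports Defs
begin

text \<open>
  Let \<open>S A\<close> and \<open>R A\<close> be the products over \<open>A\<close> of the projectors with exact and with rounded angles.
  Conjugation by the diagonal phases of the graph state \<open>G\<close> turns each \<open>S A\<close> into projectors onto the
  plus state on \<open>A\<close>, so the \<open>S A\<close> commute, fix \<open>G\<close>, and satisfy
  \<open>1 - proj G \<le> (\<Sum>A. 1 - S A)\<close>.  The test operator \<open>P A\<close> has eigenvalue 1 on the range of \<open>R A\<close> and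
  eigenvalues at most \<open>1 - 1/h\<close> elsewhere, hence \<open>1 - R A \<le> h (1 - P A)\<close>, and exchanging the exact
  angles for the rounded ones site by site gives \<open>R A - S A \<le> card A * sin (pi / 4h)\<close>.  Taking
  expectations in the resultant state reduces the second part to \<open>1 - tr (\<sigma> \<Omega>) \<le> (1 - \<beta>) / (\<beta> N)\<close>,
  which follows from \<open>(\<Sum>i. \<Omega>\<^sup>(\<^sup>i\<^sup>)) \<le> 1 + N \<Omega> \<otimes> \<dots> \<otimes> \<Omega>\<close>.
  For the first part, compress \<open>P A\<close> by \<open>S A\<close>: each site contributes at least
  \<open>1 - sin\<^sup>2 (pi / 4h) / h\<close>.
\<close>

subsection \<open>Positive operators\<close>

text \<open>
  Positive semidefiniteness, with the rank-one decomposition built in so that products under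
  \<open>tensor_op\<close> and traces against a density operator need no spectral theorem.
\<close>

definition pos_op :: "'b::finite cmat \<Rightarrow> bool" where
  "pos_op M \<longleftrightarrow> (\<exists>vs. M = sum_list (map proj vs))"

lemma pos_op_0: "pos_op 0"
  unfolding pos_op_def by (rule exI[of _ "[]"]) simp

lemma pos_op_proj: "pos_op (proj v)"
  unfolding pos_op_def by (rule exI[of _ "[v]"]) simp

lemma pos_op_add:
  assumes "pos_op M" "pos_op M'"
  shows "pos_op (M + M')"
proof -
  obtain vs ws where "M = sum_list (map proj vs)" "M' = sum_list (map proj ws)"
    using assms by (auto simp: pos_op_def)
  then have "M + M' = sum_list (map proj (vs @ ws))" by simp
  then show ?thesis unfolding pos_op_def by blast
qed

lemma pos_op_sum: "(\<And>x. x \<in> S \<Longrightarrow> pos_op (f x)) \<Longrightarrow> pos_op (\<Sum>x\<in>S. f x)"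
  by (induction S rule: infinite_finite_induct) (auto intro: pos_op_0 pos_op_add)

lemma pos_op_scaleR:
  assumes "pos_op M" "0 \<le> c"
  shows "pos_op (c *\<^sub>R M)"
proof -
  obtain vs where "M = sum_list (map proj vs)"
    using assms by (auto simp: pos_op_def)
  moreover have "c *\<^sub>R proj v = proj (sqrt c *\<^sub>R v)" for v :: "'a cvec"
    using assms(2) by (simp add: ketbra_def vec_eq_iff flip: mult.assoc)
  ultimately have "c *\<^sub>R M = sum_list (map proj (map (\<lambda>v. sqrt c *\<^sub>R v) vs))"
    by (induction vs arbitrary: M) (auto simp: scaleR_add_right)
  then show ?thesis unfolding pos_op_def by blast
qed

text \<open>An indexed sum replaces the list, so that \<open>tensor_op_sum\<close> can choose one
  summand per site.\<close>

lemma pos_op_decompose: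
  assumes "pos_op M"
  obtains k :: nat and v where "M = (\<Sum>j<k. proj (v j))"
proof -
  obtain vs where "M = sum_list (map proj vs)"
    using assms by (auto simp: pos_op_def)
  then have "M = (\<Sum>j<length vs. proj (vs ! j))"
    by (simp add: sum_list_sum_nth atLeast0LessThan)
  then show ?thesis by (rule that)
qed

lemma proj_tensor_vec: "proj (tensor_vec v) = tensor_op (\<lambda>i. proj (v i))"
  by (simp add: tensor_vec_def tensor_op_def ketbra_def vec_eq_iff prod.distrib)

text \<open>Entrywise this is distributivity of a product over sums, with \<open>s\<close> recording
  the summand taken at each site.\<close>

lemma tensor_op_sum:
  fixes M :: "'i::finite \<Rightarrow> 'x \<Rightarrow> 'b::finite cmat"
  assumes "\<And>i. finite (X i)"
  shows "tensor_op (\<lambda>i. \<Sum>x\<in>X i. M i x) = (\<Sum>s\<in>PiE UNIV X. tensor_op (\<lambda>i. M i (s i)))"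
  using assms by (simp add: tensor_op_def vec_eq_iff prod_sum_PiE)

lemma tensor_op_scaleR:
  "tensor_op (\<lambda>i. c i *\<^sub>R M i) = (\<Prod>i\<in>UNIV. c i) *\<^sub>R tensor_op M"
proof -
  have "(\<Prod>i\<in>UNIV. c i *\<^sub>R M i $ b i $ b' i) =
      (\<Prod>i\<in>UNIV. c i) *\<^sub>R (\<Prod>i\<in>UNIV. M i $ b i $ b' i)" for b b'
    by (simp only: scaleR_conv_of_real prod.distrib of_real_prod)
  then show ?thesis
    by (simp only: tensor_op_def vec_eq_iff vec_lambda_beta vector_scaleR_component) blast
qed

text \<open>Splitting all factors into rank-one summands leaves tensor products of rank-one
  operators, and these are rank one by \<open>proj_tensor_vec\<close>.\<close>

lemma pos_op_tensor_op:
  fixes M :: "'i::finite \<Rightarrow> 'b::finite cmat"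
  assumes "\<And>i. pos_op (M i)"
  shows "pos_op (tensor_op M)"
proof -
  \<comment> \<open>The number of summands and the vectors are packed into one pair, so that a
    single use of choice serves both.\<close>
  have "\<exists>w :: nat \<times> (nat \<Rightarrow> 'b cvec). M i = (\<Sum>j<fst w. proj (snd w j))" for i
    by (rule pos_op_decompose[OF assms[of i]]) auto
  then have "\<forall>i. \<exists>w :: nat \<times> (nat \<Rightarrow> 'b cvec). M i = (\<Sum>j<fst w. proj (snd w j))"
    by blast
  then obtain w :: "'i \<Rightarrow> nat \<times> (nat \<Rightarrow> 'b cvec)"
    where M: "\<forall>i. M i = (\<Sum>j<fst (w i). proj (snd (w i) j))"
    by (rule choice[THEN exE])
  have "tensor_op M = tensor_op (\<lambda>i. \<Sum>j\<in>{..<fst (w i)}. proj (snd (w i) j))"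
    using M by (intro arg_cong[where f = tensor_op] ext) blast
  also have "\<dots> = (\<Sum>s\<in>PiE UNIV (\<lambda>i. {..<fst (w i)}). proj (tensor_vec (\<lambda>i. snd (w i) (s i))))"
    by (simp only: tensor_op_sum[OF finite_lessThan] proj_tensor_vec)
  finally show ?thesis
    by (simp only: pos_op_sum pos_op_proj)
qed

section \<open>Traces and expectation values\<close>

lemma trace_proj_mult: "trace (proj v ** M) = cinner v (M *v v)"
  unfolding trace_mult
  by (subst sum.swap)
     (simp add: ketbra_def cinner_def matrix_vector_mult_def sum_distrib_left ac_simps)

lemma trace_mult_proj: "trace (M ** proj v) = cinner v (M *v v)"
  by (simp add: trace_mul_sym[of M] trace_proj_mult)

lemma trace_sum: "trace (\<Sum>x\<in>S. f x) = (\<Sum>x\<in>S. trace (f x))"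
  for f :: "'x \<Rightarrow> 'b::finite cmat"
  unfolding trace_def by (simp add: sum.swap[of _ UNIV S])

text \<open>Only \<open>M\<close> is split into rank-one terms; \<open>R\<close> enters through its
  quadratic form alone, which is what \<open>density_op\<close> supplies.\<close>

lemma trace_pos_op_nonneg:
  assumes "pos_op M" and "\<And>v. 0 \<le> Re (cinner v (R *v v))"
  shows "0 \<le> Re (trace (M ** R))"
proof -
  obtain k v where "M = (\<Sum>j<(k::nat). proj (v j))"
    by (rule pos_op_decompose[OF assms(1)])
  then have "trace (M ** R) = (\<Sum>j<k. cinner (v j) (R *v v j))"
    by (simp add: matrix_mult_sum trace_sum trace_proj_mult)
  then show ?thesis by (simp add: assms(2) sum_nonneg)
qed

lemma pos_op_hermitian:
  assumes "pos_op M"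
  shows "cnj (M $ i $ j) = M $ j $ i"
proof -
  obtain k v where "M = (\<Sum>j<(k::nat). proj (v j))"
    by (rule pos_op_decompose[OF assms(1)])
  then show ?thesis by (simp add: ketbra_def mult.commute)
qed

lemma cinner_pos_op_left:
  assumes "pos_op M"
  shows "cinner (M *v v) w = cinner v (M *v w)"
  unfolding cinner_def matrix_vector_mult_def
  by (simp add: sum_distrib_left sum_distrib_right pos_op_hermitian[OF assms], subst sum.swap)
     (simp add: ac_simps)

lemma cinner_commute: "cinner v w = cnj (cinner w v)"
  by (simp add: cinner_def mult.commute)

lemma cinner_pos_op:
  assumes "pos_op M"
  shows "cinner v (M *v v) = complex_of_real (Re (cinner v (M *v v)))" "0 \<le> Re (cinner v (M *v v))"
proof -
  have "cinner v (M *v v) = cnj (cinner v (M *v v))"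
    by (subst cinner_commute) (simp only: cinner_pos_op_left[OF assms])
  then show "cinner v (M *v v) = complex_of_real (Re (cinner v (M *v v)))"
    by (simp add: complex_eq_iff)
  have "proj v *v w = cinner v w *s v" for w
    by (simp add: cinner_def ketbra_def matrix_vector_mult_def vec_eq_iff sum_distrib_left sum_distrib_right ac_simps)
  moreover have "cinner w (c *s v) = c * cinner w v" for w c
    by (simp add: cinner_def sum_distrib_left ac_simps)
  ultimately have "cinner w (proj v *v w) = cnj (cinner w v) * cinner w v" for w
    by (simp add: cinner_commute[of v w])
  then have "0 \<le> Re (cinner w (proj v *v w))" for w
    by simp
  \<comment> \<open>The quadratic form of \<open>proj v\<close> at \<open>w\<close> is the squared
    modulus of an inner product, so \<open>R = proj v\<close> is admissible and the trace becomes
    the expectation of \<open>M\<close> at \<open>v\<close>.\<close>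
  from trace_pos_op_nonneg[OF assms this] show "0 \<le> Re (cinner v (M *v v))"
    by (simp add: trace_mult_proj)
qed

section \<open>Algebra of tensor products\<close>

lemma tensor_op_mat_1: "tensor_op (\<lambda>_. mat 1) = mat 1"
  by (auto simp: tensor_op_def mat_def vec_eq_iff fun_eq_iff)

lemma tensor_op_mult_vec: "tensor_op A *v tensor_vec v = tensor_vec (\<lambda>i. A i *v v i)"
proof -
  have "(\<Sum>g\<in>UNIV. (\<Prod>i\<in>UNIV. A i $ b i $ g i) * (\<Prod>i\<in>UNIV. v i $ g i)) =
        (\<Prod>i\<in>UNIV. \<Sum>x\<in>UNIV. A i $ b i $ x * v i $ x)" for b
    by (subst prod_sum_PiE) (auto simp: prod.distrib PiE_UNIV_domain)
  then show ?thesis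
    by (simp add: tensor_op_def tensor_vec_def matrix_vector_mult_def vec_eq_iff)
qed

lemma cinner_tensor_vec: "cinner (tensor_vec v) (tensor_vec w) = (\<Prod>i\<in>UNIV. cinner (v i) (w i))"
  unfolding cinner_def tensor_vec_def
  by (subst prod_sum_PiE) (auto simp: prod.distrib PiE_UNIV_domain)

text \<open>The Boolean \<open>s i\<close> selects the summand at site \<open>i\<close>. With the
  operators fixed and only the weights varied, several operators share one expansion; when its terms
  are positive, an operator inequality reduces to one between coefficients.\<close>

lemma tensor_op_expand:
  fixes P R :: "'i::finite \<Rightarrow> 'b::finite cmat"
  shows "tensor_op (\<lambda>i. a i *\<^sub>R P i + b i *\<^sub>R R i) =
    (\<Sum>s\<in>UNIV. (\<Prod>i\<in>UNIV. if s i then a i else b i) *\<^sub>R tensor_op (\<lambda>i. if s i then P i else R i))"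
proof -
  have "tensor_op (\<lambda>i. a i *\<^sub>R P i + b i *\<^sub>R R i) =
      tensor_op (\<lambda>i. \<Sum>x\<in>UNIV. (if x then a i else b i) *\<^sub>R (if x then P i else R i))"
    by (simp add: UNIV_bool add.commute)
  also have "\<dots> = (\<Sum>s\<in>PiE UNIV (\<lambda>_. UNIV). tensor_op (\<lambda>i. (if s i then a i else b i) *\<^sub>R (if s i then P i else R i)))"
    by (rule tensor_op_sum) simp
  finally show ?thesis by (simp add: tensor_op_scaleR PiE_UNIV_domain)
qed

lemma tensor_op_add_at:
  "tensor_op (A(i := B + C)) = tensor_op (A(i := B)) + tensor_op (A(i := C))"
proof -
  have "(\<Prod>j\<in>UNIV. (A(i := X)) j $ b j $ b' j) =
      X $ b i $ b' i * (\<Prod>j\<in>UNIV - {i}. A j $ b j $ b' j)" for X b b'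
    by (simp add: prod.remove[of UNIV i])
  then show ?thesis
    by (simp add: tensor_op_def vec_eq_iff algebra_simps)
qed

lemma tensor_op_scaleR_at: "tensor_op (A(i := r *\<^sub>R B)) = r *\<^sub>R tensor_op (A(i := B))"
proof -
  have "(\<Prod>j\<in>UNIV. (A(i := X)) j $ b j $ b' j) =
      X $ b i $ b' i * (\<Prod>j\<in>UNIV - {i}. A j $ b j $ b' j)" for X b b'
    by (simp add: prod.remove[of UNIV i])
  then show ?thesis
    by (simp add: tensor_op_def vec_eq_iff)
qed

lemma pos_op_mat_1: "pos_op (mat 1)"
proof -
  have "proj (axis b 1) $ i $ j = (if b = i then if i = j then 1 else 0 else 0)" for b i j :: 'a
    by (auto simp: ketbra_def axis_def)
  then have "mat 1 = (\<Sum>b\<in>UNIV. proj (axis b 1 :: 'a cvec))"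
    by (simp add: vec_eq_iff mat_def)
  then show ?thesis by (simp only: pos_op_sum pos_op_proj)
qed

subsection \<open>Random sampling and controlled operators\<close>

text \<open>If every \<open>s k\<close> holds, both sides are 1. Otherwise one factor
  \<open>1 - p\<close> bounds the left product, and the right product vanishes.\<close>

lemma prod_weaken_le:
  fixes p :: real
  assumes "finite A" "0 \<le> p" "p \<le> 1"
  shows "(\<Prod>k\<in>A. if s k then 1 else 1 - p) \<le> (1 - p) + p * (\<Prod>k\<in>A. if s k then 1 else 0)"
proof (cases "\<forall>k\<in>A. s k")
  case False
  then obtain k where k: "k \<in> A" "\<not> s k" by blast
  have "(\<Prod>k\<in>A. if s k then 1 else 1 - p) = (1 - p) * (\<Prod>k\<in>A - {k}. if s k then 1 else 1 - p)"
    using assms k by (simp add: prod.remove)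
  also have "\<dots> \<le> (1 - p) * 1"
    using assms by (intro mult_left_mono prod_le_1) auto
  also have "\<dots> = (1 - p) + p * (\<Prod>k\<in>A. if s k then 1 else 0)"
    using k assms(1) by (simp add: prod.remove)
  finally show ?thesis .
qed simp

text \<open>Read \<open>s j\<close> as: copy \<open>j\<close> passes. The summand for
  \<open>i\<close> is 1 exactly when every copy other than \<open>i\<close> passes. With no failure
  both sides equal the number of copies; with a failure at \<open>k\<close> only
  \<open>i = k\<close> can contribute.\<close>

lemma sum_prod_omit_le:
  fixes s :: "'c::finite \<Rightarrow> bool"
  shows "(\<Sum>i\<in>UNIV. \<Prod>j\<in>UNIV. if s j then 1 else if j = i then 1 else 0) \<le>
    1 + (real CARD('c) - 1) * (\<Prod>j\<in>UNIV. if s j then 1 else 0)"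
proof (cases "\<forall>j. s j")
  case False
  then obtain k where k: "\<not> s k" by blast
  have "(\<Prod>j\<in>UNIV. if s j then 1 else if j = i then 1 else 0) \<le> (if i = k then 1 else 0 :: real)" for i
  proof (cases "i = k")
    case False
    then have "(\<Prod>j\<in>UNIV. if s j then 1 else if j = i then 1 else 0) = (0 :: real)"
      using k by (intro prod_zero bexI[of _ k]) auto
    then show ?thesis using False by (simp only: if_False)
  qed (auto intro!: prod_le_1)
  then have "(\<Sum>i\<in>UNIV. \<Prod>j\<in>UNIV. if s j then 1 else if j = i then 1 else (0::real)) \<le>
      (\<Sum>i\<in>UNIV. if i = k then 1 else 0)"
    by (rule sum_mono)
  moreover have "(\<Prod>j\<in>UNIV. if s j then 1 else (0::real)) = 0"
    using k by (intro prod_zero bexI[of _ k]) auto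
  ultimately show ?thesis by (simp only:) simp
qed simp

text \<open>Expanding \<open>mat 1 = \<Omega> + (mat 1 - \<Omega>)\<close> on every copy reduces the claim to numbers in \<open>{0, 1}\<close>.\<close>

lemma pos_op_random_sampling:
  fixes \<Omega> :: "'b::finite cmat"
  assumes "pos_op \<Omega>" "pos_op (mat 1 - \<Omega>)"
  shows "pos_op (mat 1 + (real CARD('c) - 1) *\<^sub>R tensor_op (\<lambda>_::'c::finite. \<Omega>) -
    (\<Sum>i\<in>UNIV. tested_except \<Omega> (i::'c)))"
proof -
  define T where "T s = tensor_op (\<lambda>i::'c. if s i then \<Omega> else mat 1 - \<Omega>)" for s
  have T: "pos_op (T s)" for s
    unfolding T_def using assms by (auto intro: pos_op_tensor_op)
  note ex = tensor_op_expand[of _ "\<lambda>_::'c. \<Omega>" _ "\<lambda>_. mat 1 - \<Omega>", folded T_def]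
  \<comment> \<open>The weight of a failing outcome is 1 for the identity, 0 for the full tensor
    power, and 1 only at copy \<open>i\<close> for \<open>tested_except\<close>.\<close>
  have 1: "mat 1 = (\<Sum>s\<in>UNIV. 1 *\<^sub>R T s)"
    using ex[of "\<lambda>_. 1" "\<lambda>_. 1"] by (simp add: tensor_op_mat_1)
  have all: "tensor_op (\<lambda>_. \<Omega>) = (\<Sum>s\<in>UNIV. (\<Prod>j\<in>UNIV. if s j then 1 else 0) *\<^sub>R T s)"
    using ex[of "\<lambda>_. 1" "\<lambda>_. 0"] by simp
  have at: "tested_except \<Omega> i =
      (\<Sum>s\<in>UNIV. (\<Prod>j\<in>UNIV. if s j then 1 else if j = i then 1 else 0) *\<^sub>R T s)" for i :: 'c
    unfolding tested_except_def ex[of "\<lambda>_. 1" "\<lambda>j. if j = i then 1 else 0", symmetric]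
    by (intro arg_cong[where f = tensor_op]) auto
  define a e where "a s = (\<Prod>j\<in>UNIV. if s j then 1 else (0::real))"
    and "e s i = (\<Prod>j\<in>UNIV. if s j then 1 else if j = i then 1 else (0::real))"
    for s :: "'c \<Rightarrow> bool" and i
  have "(\<Sum>i\<in>UNIV. tested_except \<Omega> (i::'c)) = (\<Sum>s\<in>UNIV. (\<Sum>i\<in>UNIV. e s i) *\<^sub>R T s)"
    unfolding at e_def[symmetric] scaleR_sum_left by (rule sum.swap)
  then have "mat 1 + (real CARD('c) - 1) *\<^sub>R tensor_op (\<lambda>_::'c. \<Omega>) - (\<Sum>i\<in>UNIV. tested_except \<Omega> (i::'c)) =
    (\<Sum>s\<in>UNIV. (1 + (real CARD('c) - 1) * a s - (\<Sum>i\<in>UNIV. e s i)) *\<^sub>R T s)"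
    by (simp only: 1 all a_def[symmetric] scaleR_diff_left scaleR_add_left scaleR_sum_right
          scaleR_scaleR sum.distrib sum_subtractf)
  also have "pos_op \<dots>"
    using sum_prod_omit_le unfolding a_def e_def by (intro pos_op_sum pos_op_scaleR T) (simp only: diff_ge_0_iff_ge)
  finally show ?thesis .
qed

section \<open>Operators controlled by the bits off a set of sites\<close>

text \<open>The block for the bit string \<open>z\<close> off \<open>A\<close> is the tensor product of the \<open>M z k\<close> over \<open>A\<close>.\<close>

definition controlled :: "'v::finite set \<Rightarrow> (('v \<Rightarrow> bool) \<Rightarrow> 'v \<Rightarrow> bool cmat) \<Rightarrow> ('v \<Rightarrow> bool) cmat" where
  "controlled A M = (\<Sum>z \<in> (- A) \<rightarrow>\<^sub>E UNIV. tensor_op (\<lambda>j. if j \<in> A then M z j else proj (ket (z j))))"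

text \<open>The projectors off \<open>A\<close> annihilate every summand except the one for
  \<open>restrict b (- A)\<close>, and that one too unless \<open>b\<close> and \<open>b'\<close>
  agree off \<open>A\<close>.\<close>

lemma controlled_component:
  "controlled A M $ b $ b' = (if \<forall>j. j \<notin> A \<longrightarrow> b j = b' j
     then \<Prod>k\<in>A. M (restrict b (- A)) k $ b k $ b' k else 0)"
proof -
  let ?r = "restrict b (- A)"
  define f where "f z = tensor_op (\<lambda>j. if j \<in> A then M z j else proj (ket (z j))) $ b $ b'" for z
  have f: "f z = (\<Prod>k\<in>A. M z k $ b k $ b' k) * (\<Prod>k\<in>-A. of_bool (b k = z k \<and> b' k = z k))" for z
  proof -
    have "f z = (\<Prod>j\<in>UNIV. if j \<in> A then M z j $ b j $ b' j else of_bool (b j = z j \<and> b' j = z j))"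
      unfolding f_def tensor_op_def vec_lambda_beta
      by (intro prod.cong) (auto simp: ketbra_def ket_def axis_def)
    also have "\<dots> = (\<Prod>k\<in>A. M z k $ b k $ b' k) * (\<Prod>k\<in>-A. of_bool (b k = z k \<and> b' k = z k))"
      by (subst prod.If_cases) (auto simp: Collect_mem_eq Collect_neg_eq)
    finally show ?thesis .
  qed
  have "f z = 0" if z: "z \<in> (- A) \<rightarrow>\<^sub>E UNIV" "z \<noteq> ?r" for z
  proof -
    obtain k where "k \<in> - A" "b k \<noteq> z k"
      using PiE_ext[OF z(1), of ?r] z(2) by auto
    then show ?thesis unfolding f by (auto intro!: prod_zero)
  qed
  then have "(\<Sum>z \<in> (- A) \<rightarrow>\<^sub>E UNIV. f z) = (\<Sum>z \<in> {?r}. f z)"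
    by (intro sum.mono_neutral_right) (auto simp: finite_PiE)
  also have "\<dots> = (if \<forall>j. j \<notin> A \<longrightarrow> b j = b' j then \<Prod>k\<in>A. M ?r k $ b k $ b' k else 0)"
    unfolding f by (auto intro!: prod_zero)
  finally show ?thesis by (simp add: controlled_def f_def)
qed

lemma controlled_mat_1: "controlled A (\<lambda>_ _. mat 1) = mat 1"
proof -
  have "controlled A (\<lambda>_ _. mat 1) $ b $ b' = mat 1 $ b $ b'" for b b'
  proof (cases "b = b'")
    case False
    then obtain k where k: "b k \<noteq> b' k" by blast
    \<comment> \<open>A disagreement off \<open>A\<close> already fails the condition in
      \<open>controlled_component\<close>; inside \<open>A\<close> it makes the product
      vanish.\<close>
    have "(\<Prod>k\<in>A. (mat 1 :: bool cmat) $ b k $ b' k) = 0" if "k \<in> A"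
      using that k by (intro prod_zero bexI[of _ k]) (simp_all add: mat_def)
    then have "controlled A (\<lambda>_ _. mat 1) $ b $ b' = 0"
      unfolding controlled_component using k by metis
    then show ?thesis using False by (simp add: mat_def)
  qed (simp add: controlled_component mat_def)
  then show ?thesis by (simp only: vec_eq_iff) blast
qed

lemma proj_ket_component: "proj (ket a) $ i $ j = of_bool (i = a \<and> j = a)"
  by (simp add: ketbra_def ket_def axis_def)

lemma proj_ket_mult: "proj (ket a) ** proj (ket b) = (if a = b then proj (ket a) else 0)"
  by (cases a; cases b) (auto simp: vec_eq_iff matrix_matrix_mult_def proj_ket_component UNIV_bool)

lemma tensor_op_0_at:
  assumes "A i = 0"
  shows "tensor_op A = 0"
proof -
  have "(\<Prod>j\<in>UNIV. A j $ b j $ b' j) = 0" for b b'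
    by (intro prod_zero bexI[of _ i]) (simp_all add: assms)
  then show ?thesis
    by (simp add: tensor_op_def vec_eq_iff)
qed

text \<open>Blocks for different bit strings are orthogonal because their projectors differ at some
  site off \<open>A\<close>, so only equal strings meet and the site operators multiply.\<close>

lemma controlled_mult: "controlled A M ** controlled A M' = controlled A (\<lambda>z k. M z k ** M' z k)"
proof -
  define T where "T M z = tensor_op (\<lambda>j. if j \<in> A then M z j else proj (ket (z j)))" for M z
  have T: "T M z ** T M' z' = (if z = z' then T (\<lambda>z k. M z k ** M' z k) z else 0)"
    if z: "z \<in> (- A) \<rightarrow>\<^sub>E UNIV" "z' \<in> (- A) \<rightarrow>\<^sub>E UNIV" for z z'
  proof (cases "z = z'")
    case False
    then obtain k where "k \<in> - A" "z k \<noteq> z' k"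
      using PiE_ext[OF z] by blast
    then have "T M z ** T M' z' = 0"
      unfolding T_def tensor_op_mult
      by (intro tensor_op_0_at[of _ k]) (simp add: proj_ket_mult)
    then show ?thesis using False by simp
  next
    case True
    have "T M z ** T M' z = T (\<lambda>z k. M z k ** M' z k) z"
      unfolding T_def tensor_op_mult
      by (intro arg_cong[where f = tensor_op] ext) (simp add: proj_ket_mult)
    then show ?thesis using True by simp
  qed
  have "controlled A M ** controlled A M' = (\<Sum>z \<in> (- A) \<rightarrow>\<^sub>E UNIV. \<Sum>z' \<in> (- A) \<rightarrow>\<^sub>E UNIV. T M z ** T M' z')"
    unfolding controlled_def T_def[symmetric] matrix_mult_sum by (rule sum.swap)
  also have "\<dots> = (\<Sum>z \<in> (- A) \<rightarrow>\<^sub>E UNIV. \<Sum>z' \<in> (- A) \<rightarrow>\<^sub>E UNIV.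
      if z = z' then T (\<lambda>z k. M z k ** M' z k) z else 0)"
    by (intro sum.cong refl T)
  also have "\<dots> = (\<Sum>z \<in> (- A) \<rightarrow>\<^sub>E UNIV. T (\<lambda>z k. M z k ** M' z k) z)"
    by (intro sum.cong refl) (simp add: finite_PiE)
  finally show ?thesis by (simp add: controlled_def T_def)
qed

subsection \<open>Comparison of controlled operators\<close>

text \<open>Expand each \<open>M' i\<close> as \<open>M i + (M' i - M i)\<close>: the term with
  \<open>M i\<close> at every site is \<open>tensor_op M\<close>, and all other terms are
  positive.\<close>

lemma pos_op_tensor_op_mono:
  fixes M M' :: "'i::finite \<Rightarrow> 'b::finite cmat"
  assumes "\<And>i. pos_op (M i)" "\<And>i. pos_op (M' i - M i)"
  shows "pos_op (tensor_op M' - tensor_op M)"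
proof -
  define T where "T s = tensor_op (\<lambda>i. if s i then M i else M' i - M i)" for s
  have "tensor_op M' = (\<Sum>s\<in>UNIV. (\<Prod>i\<in>UNIV. if s i then 1 else 1) *\<^sub>R T s)"
    using tensor_op_expand[of "\<lambda>_. 1" M "\<lambda>_. 1" "\<lambda>i. M' i - M i"] by (simp add: T_def)
  moreover have "tensor_op M = (\<Sum>s\<in>UNIV. (\<Prod>i\<in>UNIV. if s i then 1 else 0) *\<^sub>R T s)"
    using tensor_op_expand[of "\<lambda>_. 1" M "\<lambda>_. 0" "\<lambda>i. M' i - M i"] by (simp add: T_def)
  ultimately have "tensor_op M' - tensor_op M =
      (\<Sum>s\<in>UNIV. (1 - (\<Prod>i\<in>UNIV. if s i then 1 else 0)) *\<^sub>R T s)"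
    by (simp add: scaleR_diff_left sum_subtractf)
  also have "pos_op \<dots>"
    unfolding T_def using assms
    by (intro pos_op_sum pos_op_scaleR pos_op_tensor_op)
       (auto intro!: prod_le_1 split: if_split)
  finally show ?thesis .
qed

lemma pos_op_controlled:
  assumes "\<And>z k. k \<in> A \<Longrightarrow> pos_op (M z k)"
  shows "pos_op (controlled A M)"
  unfolding controlled_def
  by (intro pos_op_sum pos_op_tensor_op) (simp add: assms pos_op_proj)

lemma pos_op_controlled_mono:
  assumes "\<And>z k. k \<in> A \<Longrightarrow> pos_op (M z k)" "\<And>z k. k \<in> A \<Longrightarrow> pos_op (M' z k - M z k)"
  shows "pos_op (controlled A M' - controlled A M)"
  unfolding controlled_def sum_subtractf[symmetric]
  by (intro pos_op_sum pos_op_tensor_op_mono) (simp_all add: assms pos_op_proj pos_op_0)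

lemma controlled_cong: "(\<And>z k. k \<in> A \<Longrightarrow> M z k = M' z k) \<Longrightarrow> controlled A M = controlled A M'"
  unfolding controlled_def by (intro sum.cong refl arg_cong[where f = tensor_op] ext) simp

lemma controlled_upd:
  assumes "k \<in> A"
  shows "controlled A (\<lambda>z. (M z)(k := a *\<^sub>R X z + b *\<^sub>R Y z)) =
    a *\<^sub>R controlled A (\<lambda>z. (M z)(k := X z)) + b *\<^sub>R controlled A (\<lambda>z. (M z)(k := Y z))"
proof -
  have upd: "(\<lambda>j. if j \<in> A then ((M z)(k := Z)) j else proj (ket (z j))) =
      (\<lambda>j. if j \<in> A then M z j else proj (ket (z j)))(k := Z)" for z Z
    using assms by auto
  show ?thesis
    unfolding controlled_def upd tensor_op_add_at tensor_op_scaleR_at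
    by (simp only: sum.distrib scaleR_sum_right)
qed

lemma controlled_scaleR:
  "controlled A (\<lambda>z k. c k *\<^sub>R M z k) = (\<Prod>k\<in>A. c k) *\<^sub>R controlled A M"
proof -
  have "tensor_op (\<lambda>j. if j \<in> A then c j *\<^sub>R M z j else proj (ket (z j))) =
      (\<Prod>k\<in>A. c k) *\<^sub>R tensor_op (\<lambda>j. if j \<in> A then M z j else proj (ket (z j)))" for z
  proof -
    have "(\<lambda>j. if j \<in> A then c j *\<^sub>R M z j else proj (ket (z j))) =
        (\<lambda>j. (if j \<in> A then c j else 1) *\<^sub>R (if j \<in> A then M z j else proj (ket (z j))))"
      by auto
    then show ?thesis
      by (simp only: tensor_op_scaleR) (simp add: prod.If_cases)
  qed
  then show ?thesis by (simp add: controlled_def scaleR_sum_right)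
qed

lemma controlled_expand:
  fixes M :: "('v::finite \<Rightarrow> bool) \<Rightarrow> 'v \<Rightarrow> bool cmat"
  shows "controlled A (\<lambda>z k. M z k + b *\<^sub>R (mat 1 - M z k)) =
    (\<Sum>z \<in> (- A) \<rightarrow>\<^sub>E UNIV. \<Sum>s\<in>UNIV. (\<Prod>k\<in>A. if s k then 1 else b) *\<^sub>R
      tensor_op (\<lambda>j. if s j then if j \<in> A then M z j else proj (ket (z j))
                      else if j \<in> A then mat 1 - M z j else 0))"
proof -
  \<comment> \<open>Off \<open>A\<close> a zero second summand with weight 1 lets
    \<open>tensor_op_expand\<close> run over all sites, while the weights still multiply to a
    product over \<open>A\<close>.\<close>
  have "tensor_op (\<lambda>j. if j \<in> A then M z j + b *\<^sub>R (mat 1 - M z j) else proj (ket (z j))) =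
    tensor_op (\<lambda>j. 1 *\<^sub>R (if j \<in> A then M z j else proj (ket (z j))) +
      (if j \<in> A then b else 1) *\<^sub>R (if j \<in> A then mat 1 - M z j else 0))" for z
    by (intro arg_cong[where f = tensor_op] ext) simp
  moreover have "(\<Prod>i\<in>UNIV. if s i then 1 else if i \<in> A then b else 1) =
      (\<Prod>k\<in>A. if s k then 1 else b)" for s :: "'v \<Rightarrow> bool"
    by (rule prod.mono_neutral_cong_right) auto
  ultimately show ?thesis
    by (simp only: controlled_def tensor_op_expand)
qed

text \<open>In the eigenbasis labelled by \<open>s\<close> the claim is \<open>prod_weaken_le\<close>.\<close>

lemma pos_op_controlled_weaken:
  assumes "\<And>z k. k \<in> A \<Longrightarrow> pos_op (M z k)" "\<And>z k. k \<in> A \<Longrightarrow> pos_op (mat 1 - M z k)"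
    and p: "0 \<le> p" "p \<le> 1"
  shows "pos_op ((1 - p) *\<^sub>R mat 1 + p *\<^sub>R controlled A M - controlled A (\<lambda>z k. p *\<^sub>R M z k + (1 - p) *\<^sub>R mat 1))"
proof -
  define T where "T z s = tensor_op (\<lambda>j. if s j then if j \<in> A then M z j else proj (ket (z j))
                      else if j \<in> A then mat 1 - M z j else 0)" for z s
  have T: "pos_op (T z s)" for z s
    unfolding T_def by (intro pos_op_tensor_op) (simp add: assms pos_op_proj pos_op_0)
  define c where "c b s = (\<Prod>k\<in>A. if s k then 1 else (b::real))" for b s
  note ex = controlled_expand[of A M, folded T_def c_def]
  \<comment> \<open>The three operators are the same expansion at \<open>b = 1\<close>,
    \<open>b = 0\<close> and \<open>b = 1 - p\<close>.\<close>
  have 1: "mat 1 = (\<Sum>z \<in> (- A) \<rightarrow>\<^sub>E UNIV. \<Sum>s\<in>UNIV. c 1 s *\<^sub>R T z s)"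
    unfolding ex[symmetric] using controlled_mat_1[of A] by simp
  have 2: "controlled A M = (\<Sum>z \<in> (- A) \<rightarrow>\<^sub>E UNIV. \<Sum>s\<in>UNIV. c 0 s *\<^sub>R T z s)"
    unfolding ex[symmetric] by simp
  have "p *\<^sub>R M z k + (1 - p) *\<^sub>R mat 1 = M z k + (1 - p) *\<^sub>R (mat 1 - M z k)" for z k
    by (simp add: algebra_simps)
  then have 3: "controlled A (\<lambda>z k. p *\<^sub>R M z k + (1 - p) *\<^sub>R mat 1) =
      (\<Sum>z \<in> (- A) \<rightarrow>\<^sub>E UNIV. \<Sum>s\<in>UNIV. c (1 - p) s *\<^sub>R T z s)"
    unfolding ex[symmetric] by simp
  have "(1 - p) *\<^sub>R mat 1 + p *\<^sub>R controlled A M - controlled A (\<lambda>z k. p *\<^sub>R M z k + (1 - p) *\<^sub>R mat 1) =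
      (\<Sum>z \<in> (- A) \<rightarrow>\<^sub>E UNIV. \<Sum>s\<in>UNIV. ((1 - p) * c 1 s + p * c 0 s - c (1 - p) s) *\<^sub>R T z s)"
    unfolding 1 2 3
    by (simp only: scaleR_diff_left scaleR_add_left sum.distrib sum_subtractf scaleR_sum_right scaleR_scaleR)
  also have "pos_op \<dots>"
    using prod_weaken_le[OF _ p, of A] unfolding c_def
    by (intro pos_op_sum pos_op_scaleR T) simp
  finally show ?thesis .
qed

text \<open>Exchanges \<open>M'\<close> for \<open>M\<close> one site at a time, each exchange costing \<open>e\<close>.\<close>

lemma pos_op_controlled_telescope:
  fixes A :: "'v::finite set"
  assumes M: "\<And>z k. k \<in> A \<Longrightarrow> pos_op (M z k)" "\<And>z k. k \<in> A \<Longrightarrow> pos_op (mat 1 - M z k)"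
    and M': "\<And>z k. k \<in> A \<Longrightarrow> pos_op (M' z k)" "\<And>z k. k \<in> A \<Longrightarrow> pos_op (mat 1 - M' z k)"
    and d: "\<And>z k. k \<in> A \<Longrightarrow> pos_op (e *\<^sub>R mat 1 - (M z k - M' z k))"
    and e: "0 \<le> e"
  shows "pos_op ((real (card A) * e) *\<^sub>R mat 1 - (controlled A M - controlled A M'))"
proof -
  \<comment> \<open>\<open>N B\<close> is the hybrid with \<open>M\<close> on \<open>B\<close> and
    \<open>M'\<close> elsewhere; the case \<open>B = A\<close> is the claim.\<close>
  define N where "N B z j = (if j \<in> B then M z j else M' z j)" for B z j
  have "pos_op ((real (card B) * e) *\<^sub>R mat 1 - (controlled A (N B) - controlled A M'))" if "B \<subseteq> A" for B
    using finite[of B] that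
  proof (induction B rule: finite_induct)
    case empty
    then show ?case by (simp add: N_def pos_op_0)
  next
    case (insert k B)
    then have k: "k \<in> A" by simp
    define D where "D z = M z k - M' z k" for z
    have upd: "controlled A (\<lambda>z. (N B z)(k := e *\<^sub>R mat 1 - D z)) =
        e *\<^sub>R controlled A (\<lambda>z. (N B z)(k := mat 1)) - controlled A (\<lambda>z. (N B z)(k := D z))"
      using controlled_upd[OF k, of "N B" e "\<lambda>_. mat 1" "-1" D] by simp
    have diff: "controlled A (\<lambda>z. (N B z)(k := D z)) = controlled A (N (insert k B)) - controlled A (N B)"
    proof -
      have "(N B z)(k := M z k) = N (insert k B) z" "(N B z)(k := M' z k) = N B z" for z
        using insert by (auto simp: N_def)
      then show ?thesis
        using controlled_upd[OF k, of "N B" 1 "\<lambda>z. M z k" "-1" "\<lambda>z. M' z k"] by (simp add: D_def)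
    qed
    have p1: "pos_op (controlled A (\<lambda>z. (N B z)(k := e *\<^sub>R mat 1 - D z)))"
      using M(1) M'(1) d by (intro pos_op_controlled) (auto simp: N_def D_def)
    have p2: "pos_op (controlled A (\<lambda>_ _. mat 1) - controlled A (\<lambda>z. (N B z)(k := mat 1)))"
      using M M' by (intro pos_op_controlled_mono) (auto simp: N_def pos_op_0 pos_op_mat_1)
    \<comment> \<open>The three summands are the bound for \<open>B\<close>, the slack from putting
      the identity at every site, and the positive operator with
      \<open>e *\<^sub>R mat 1 - D z\<close> at site \<open>k\<close>.\<close>
    have "pos_op (((real (card B) * e) *\<^sub>R mat 1 - (controlled A (N B) - controlled A M')) +
        (e *\<^sub>R (mat 1 - controlled A (\<lambda>z. (N B z)(k := mat 1))) +
         (e *\<^sub>R controlled A (\<lambda>z. (N B z)(k := mat 1)) - (controlled A (N (insert k B)) - controlled A (N B)))))"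
      using insert p1 p2 e unfolding upd diff controlled_mat_1
      by (intro pos_op_add pos_op_scaleR) auto
    also have "((real (card B) * e) *\<^sub>R mat 1 - (controlled A (N B) - controlled A M')) +
        (e *\<^sub>R (mat 1 - controlled A (\<lambda>z. (N B z)(k := mat 1))) +
         (e *\<^sub>R controlled A (\<lambda>z. (N B z)(k := mat 1)) - (controlled A (N (insert k B)) - controlled A (N B)))) =
        (real (card (insert k B)) * e) *\<^sub>R mat 1 - (controlled A (N (insert k B)) - controlled A M')"
      using insert by (simp add: algebra_simps)
    finally show ?case .
  qed
  from this[OF order_refl] show ?thesis
    by (simp add: N_def cong: controlled_cong)
qed

section \<open>Angle states of a qubit and the rounding error\<close>

lemma ket_angle_component: "ket_angle a $ i = cis (a * of_bool i) / sqrt 2"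
  by (cases i) (simp_all add: ket_angle_def ket_def axis_def, simp_all add: scaleR_conv_of_real)

lemma proj_ket_angle_component:
  "proj (ket_angle a) $ i $ j = cis (a * (of_bool i - of_bool j)) / 2"
proof -
  have "complex_of_real (sqrt 2) * complex_of_real (sqrt 2) = 2"
    by (simp flip: of_real_mult)
  then show ?thesis
    by (simp add: ketbra_def ket_angle_component cis_cnj cis_mult right_diff_distrib)
qed

text \<open>The state orthogonal to an angle state is the antipodal angle state, so the complements
  of the site projectors are again rank one and \<open>pos_op\<close> applies to them.\<close>

lemma proj_ket_angle_complement: "mat 1 - proj (ket_angle a) = proj (ket_angle (a + pi))"
proof -
  have "cis (x + pi) = - cis x" "cis (x - pi) = - cis x" for x
    by (simp_all add: complex_eq_iff)
  then show ?thesis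
    by (simp add: vec_eq_iff all_bool_eq proj_ket_angle_component mat_def)
qed

text \<open>The difference of the two projectors is Hermitian with zero diagonal. Its eigenvectors
  are the angle state at \<open>\<phi>\<close> and its antipode, with eigenvalues of opposite sign
  whose modulus is the sine of half the angle difference.\<close>

lemma pos_op_ket_angle_diff:
  assumes "\<bar>sin ((a - b) / 2)\<bar> \<le> e"
  shows "pos_op (e *\<^sub>R mat 1 - (proj (ket_angle a) - proj (ket_angle b)))"
proof -
  \<comment> \<open>\<open>\<phi>\<close> is the mean angle turned by \<open>pi / 2\<close>, which
    is the direction of \<open>cis b - cis a\<close>; \<open>t\<close> is the signed eigenvalue at
    the antipode.\<close>
  define \<phi> t where "\<phi> = (a + b + pi) / 2" and "t = sin ((b - a) / 2)"
  have c: "cis b - cis a = 2 * t * cis \<phi>"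
  proof -
    have "cis b = cis ((a + b) / 2) * cis ((b - a) / 2)" "cis a = cis ((a + b) / 2) * cis (- ((b - a) / 2))"
      unfolding cis_mult by (simp_all add: field_simps)
    moreover have "cis \<phi> = \<i> * cis ((a + b) / 2)"
      by (simp add: \<phi>_def add_divide_distrib flip: cis_mult)
    moreover have "cis x - cis (- x) = 2 * \<i> * sin x" for x
      by (simp add: complex_eq_iff)
    ultimately show ?thesis
      by (simp add: t_def flip: right_diff_distrib)
  qed
  then have c': "cis (- b) - cis (- a) = 2 * t * cis (- \<phi>)"
    by (metis (no_types, lifting) cis_cnj complex_cnj_diff complex_cnj_mult complex_cnj_complex_of_real complex_cnj_numeral)
  have "e *\<^sub>R mat 1 - (proj (ket_angle a) - proj (ket_angle b)) =
      (e + t) *\<^sub>R proj (ket_angle \<phi>) + (e - t) *\<^sub>R (mat 1 - proj (ket_angle \<phi>))"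
    using c c'
    by (simp add: vec_eq_iff all_bool_eq proj_ket_angle_component mat_def)
       (simp add: scaleR_conv_of_real field_simps)
  also have "pos_op \<dots>"
  proof -
    have "\<bar>t\<bar> \<le> e"
      using assms unfolding t_def by (metis abs_minus_cancel minus_diff_eq minus_divide_left sin_minus)
    then show ?thesis
      unfolding proj_ket_angle_complement by (intro pos_op_add pos_op_scaleR pos_op_proj) auto
  qed
  finally show ?thesis .
qed

lemma ketbra_mult: "ketbra v w ** ketbra u x = ketbra (cinner w u *s v) x"
  by (simp add: vec_eq_iff matrix_matrix_mult_def ketbra_def cinner_def sum_distrib_left sum_distrib_right ac_simps)

lemma proj_sandwich: "proj v ** proj w ** proj v = (cmod (cinner v w))\<^sup>2 *\<^sub>R proj v"
proof -
  have "proj v ** proj w ** proj v = (\<chi> i j. cinner v w * cinner w v * proj v $ i $ j)"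
    unfolding ketbra_mult by (simp add: vec_eq_iff ketbra_def ac_simps)
  also have "cinner v w * cinner w v = complex_of_real ((cmod (cinner v w))\<^sup>2)"
    by (simp only: cinner_commute[of w v] complex_norm_square)
  finally show ?thesis
    by (simp add: vec_eq_iff) (simp add: scaleR_conv_of_real)
qed

lemma cmod_cinner_ket_angle: "(cmod (cinner (ket_angle a) (ket_angle b)))\<^sup>2 = 1 - (sin ((a - b) / 2))\<^sup>2"
proof -
  have "cinner (ket_angle a) (ket_angle b) = (1 + cis (b - a)) / 2"
    by (simp add: cinner_def ket_angle_component UNIV_bool cis_cnj cis_mult field_simps flip: of_real_mult)
  moreover have "(cmod ((1 + cis x) / 2))\<^sup>2 = ((1 + cos x)\<^sup>2 + (sin x)\<^sup>2) / 4" for x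
    by (simp add: norm_divide power_divide cmod_power2)
  ultimately have "(cmod (cinner (ket_angle a) (ket_angle b)))\<^sup>2 =
      ((1 + cos (b - a))\<^sup>2 + (sin (b - a))\<^sup>2) / 4"
    by (simp only:)
  also have "\<dots> = (1 + cos (b - a)) / 2"
  proof -
    have "((1 + c)\<^sup>2 + s\<^sup>2) / 4 = (1 + c) / 2" if "s\<^sup>2 + c\<^sup>2 = 1" for c s :: real
      using that by (simp add: power2_sum field_simps)
    then show ?thesis by simp
  qed
  also have "cos (b - a) = cos (2 * ((a - b) / 2))"
    using cos_minus[of "a - b"] by (simp only: minus_diff_eq nonzero_mult_div_cancel_left times_divide_eq_right)
  also have "(1 + \<dots>) / 2 = 1 - (sin ((a - b) / 2))\<^sup>2"
    unfolding cos_double_sin by simp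
  finally show ?thesis .
qed

lemma round_angle_bound:
  assumes "h \<ge> 1"
  shows "\<bar>round_angle h \<alpha> - \<alpha>\<bar> \<le> pi / (2 * real h)"
  using theI'[OF ex1_round[OF assms, of \<alpha>]] unfolding round_angle_def by auto

text \<open>The rounding error is at most \<open>pi / (2 * real h)\<close>, so its half stays
  between \<open>- pi / 2\<close> and \<open>pi / 2\<close>, where the modulus of the sine grows
  with the modulus of the argument.\<close>

lemma sin_round_angle_bound:
  assumes "h \<ge> 1"
  shows "\<bar>sin ((round_angle h \<alpha> - \<alpha>) / 2)\<bar> \<le> sin (pi / (4 * real h))"
proof -
  define x where "x = (round_angle h \<alpha> - \<alpha>) / 2"
  have x: "\<bar>x\<bar> \<le> pi / (4 * real h)"
    using round_angle_bound[OF assms, of \<alpha>] by (simp add: x_def)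
  have "pi / (4 * real h) \<le> pi / 2"
    using assms by (intro divide_left_mono) auto
  then have "sin \<bar>x\<bar> \<le> sin (pi / (4 * real h))"
    using x by (intro sin_monotone_2pi_le) auto
  moreover have "\<bar>sin x\<bar> = sin \<bar>x\<bar>"
  proof -
    have "0 \<le> sin \<bar>x\<bar>"
      using x \<open>pi / (4 * real h) \<le> pi / 2\<close> pi_gt_zero by (intro sin_ge_zero) linarith+
    then show ?thesis by (auto simp: abs_if)
  qed
  ultimately show ?thesis by (simp add: x_def)
qed

subsection \<open>The graph state and its exact projectors\<close>

text \<open>The exponent of the diagonal entry at \<open>b\<close> of the product of all controlled
  phases, see \<open>op_prod_cphase_component\<close>.\<close>

definition phase :: "('v::finite \<times> 'v) set \<Rightarrow> ('v \<Rightarrow> 'v \<Rightarrow> real) \<Rightarrow> ('v \<Rightarrow> bool) \<Rightarrow> real" where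
  "phase E \<theta> b = (\<Sum>(j, k)\<in>E. \<theta> j k * of_bool (b j \<and> b k))"

text \<open>Conjugation by the diagonal matrix with entries \<open>u\<close>, given entrywise; it is
  unitary when every \<open>u b\<close> has modulus 1.\<close>

definition diag_conj :: "('b::finite \<Rightarrow> complex) \<Rightarrow> 'b cmat \<Rightarrow> 'b cmat" where
  "diag_conj u M = (\<chi> b b'. u b * M $ b $ b' * cnj (u b'))"

definition diag_mul :: "('b::finite \<Rightarrow> complex) \<Rightarrow> 'b cvec \<Rightarrow> 'b cvec" where
  "diag_mul u v = (\<chi> b. u b * v $ b)"

lemma proj_diag_mul: "proj (diag_mul u v) = diag_conj u (proj v)"
  by (simp add: diag_mul_def diag_conj_def ketbra_def vec_eq_iff ac_simps)

lemma diag_conj_diff: "diag_conj u (M - M') = diag_conj u M - diag_conj u M'"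
  by (simp add: diag_conj_def vec_eq_iff algebra_simps)

lemma diag_conj_sum: "diag_conj u (\<Sum>x\<in>S. f x) = (\<Sum>x\<in>S. diag_conj u (f x))"
  by (simp add: diag_conj_def vec_eq_iff sum_distrib_left sum_distrib_right)

lemma pos_op_diag_conj:
  assumes "pos_op M"
  shows "pos_op (diag_conj u M)"
proof -
  obtain k v where "M = (\<Sum>j<(k::nat). proj (v j))"
    by (rule pos_op_decompose[OF assms])
  then have "diag_conj u M = (\<Sum>j<k. proj (diag_mul u (v j)))"
    by (simp add: diag_conj_sum proj_diag_mul)
  then show ?thesis by (simp add: pos_op_sum pos_op_proj)
qed

lemma diag_conj_mat_1:
  assumes "\<And>b. cmod (u b) = 1"
  shows "diag_conj u (mat 1) = mat 1"
  using assms by (simp add: diag_conj_def mat_def vec_eq_iff complex_norm_square[symmetric])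

lemma diag_conj_mult_diag_mul:
  assumes "\<And>b. cmod (u b) = 1"
  shows "diag_conj u M *v diag_mul u v = diag_mul u (M *v v)"
proof -
  have "cnj (u b) * u b = 1" for b
    using assms[of b] complex_norm_square[of "u b"] by (simp add: mult.commute)
  then have "u b * M $ b $ b' * cnj (u b') * (u b' * v $ b') = u b * (M $ b $ b' * v $ b')" for b b'
    by (metis (no_types, lifting) mult.assoc mult.left_commute mult.right_neutral)
  then show ?thesis
    by (simp only: diag_conj_def diag_mul_def matrix_vector_mult_def vec_eq_iff vec_lambda_beta sum_distrib_left) simp
qed

lemma cinner_diag_mul:
  assumes "\<And>b. cmod (u b) = 1"
  shows "cinner (diag_mul u v) (diag_mul u w) = cinner v w"
proof -
  have "cnj (u b) * u b = 1" for b
    using assms[of b] complex_norm_square[of "u b"] by (simp add: mult.commute)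
  then have "cnj (u b * v $ b) * (u b * w $ b) = cnj (v $ b) * w $ b" for b
    by (metis (no_types, lifting) complex_cnj_mult mult.assoc mult.left_commute mult.right_neutral)
  then show ?thesis
    by (simp only: cinner_def diag_mul_def vec_lambda_beta)
qed

section \<open>Phases of the graph state\<close>

lemma cphase_component:
  assumes "j \<noteq> k"
  shows "cphase t j k $ b $ b' = (if b = b' then cis (t * of_bool (b j \<and> b k)) else 0)"
proof (cases "b = b'")
  case True
  have 1: "tensor_op ((\<lambda>_. mat 1)(j := X)) $ b $ b = X $ b j $ b j" for X :: "bool cmat"
    by (simp add: tensor_op_def prod.remove[of UNIV j] mat_def)
  \<comment> \<open>\<open>j \<noteq> k\<close> keeps the update at \<open>k\<close> from
    overwriting the one at \<open>j\<close>.\<close>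
  have 2: "tensor_op ((\<lambda>_. mat 1)(j := X, k := Y)) $ b $ b = X $ b j $ b j * Y $ b k $ b k"
    for X Y :: "bool cmat"
  proof -
    have "(\<Prod>i\<in>UNIV. ((\<lambda>_. mat 1)(j := X, k := Y)) i $ b i $ b i) =
        (\<Prod>i\<in>{j, k}. ((\<lambda>_. mat 1)(j := X, k := Y)) i $ b i $ b i)"
      by (rule prod.mono_neutral_right) (auto simp: mat_def)
    then show ?thesis using assms by (simp add: tensor_op_def)
  qed
  have "cphase t j k $ b $ b = cis (t * of_bool (b j \<and> b k))"
    unfolding cphase_def vector_add_component 1 2
    by (cases "b j"; cases "b k") (simp_all add: ketbra_def ket_def axis_def)
  with True show ?thesis by simp
next
  case False
  then show ?thesis using is_diag_cphase[of t j k] by (simp add: is_diag_def)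
qed

lemma op_prod_cphase_component:
  assumes "\<And>j k. (j, k) \<in> E \<Longrightarrow> j \<noteq> (k :: 'v::finite)"
  shows "op_prod (\<lambda>(j, k). cphase (\<theta> j k) j k) E $ b $ b' = (if b = b' then cis (phase E \<theta> b) else 0)"
  using finite[of E] assms
proof (induction E arbitrary: b b' rule: finite_induct)
  case empty
  then show ?case by (simp add: op_prod_empty mat_def phase_def)
next
  case (insert e E)
  obtain j k where e: "e = (j, k)" by fastforce
  have jk: "j \<noteq> k" using insert.prems e by auto
  have IH: "op_prod (\<lambda>(j, k). cphase (\<theta> j k) j k) E $ c $ c' = (if c = c' then cis (phase E \<theta> c) else 0)" for c c'
    using insert.prems by (intro insert.IH) auto
  have "op_prod (\<lambda>(j, k). cphase (\<theta> j k) j k) (insert e E) =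
      cphase (\<theta> j k) j k ** op_prod (\<lambda>(j, k). cphase (\<theta> j k) j k) E"
    using insert.hyps by (subst op_prod_insert) (auto simp: e cphase_commute split: prod.split)
  also have "\<dots> $ b $ b' = (\<Sum>c\<in>UNIV. if b = c then
      if c = b' then cis (\<theta> j k * of_bool (b j \<and> b k)) * cis (phase E \<theta> b) else 0 else 0)"
    unfolding matrix_matrix_mult_def vec_lambda_beta IH cphase_component[OF jk]
    by (intro sum.cong refl) simp
  also have "\<dots> = (if b = b' then cis (phase (insert e E) \<theta> b) else 0)"
    using insert.hyps by (simp add: cis_mult phase_def e)
  finally show ?case .
qed

lemma weighted_graph_irrefl: "weighted_graph E \<theta> \<Longrightarrow> (j, k) \<in> E \<Longrightarrow> j \<noteq> k"
  by (auto simp: weighted_graph_def)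

lemma ket_plus_eq: "ket_plus = ket_angle 0"
  by (simp add: ket_plus_def ket_angle_def)

abbreviation phase_factor where
  "phase_factor E \<theta> b \<equiv> cis (phase E \<theta> b)"

text \<open>Through this form the facts on the graph state are reduced to a product of plus states,
  since the phases make up a diagonal unitary.\<close>

lemma graph_state_eq_diag_mul:
  assumes "weighted_graph E \<theta>"
  shows "graph_state E \<theta> = diag_mul (phase_factor E \<theta>) (tensor_vec (\<lambda>_. ket_angle 0))"
  using op_prod_cphase_component[of E \<theta>, OF weighted_graph_irrefl[OF assms]]
  by (simp add: graph_state_def diag_mul_def matrix_vector_mult_def vec_eq_iff ket_plus_eq if_distribR
      if_distrib[of "\<lambda>x. x * _"] cong: if_cong)

lemma cinner_ket_angle_self: "cinner (ket_angle a) (ket_angle a) = 1"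
  by (simp add: cinner_def ket_angle_component UNIV_bool cis_cnj cis_mult flip: of_real_mult)

lemma cinner_graph_state:
  assumes "weighted_graph E \<theta>"
  shows "cinner (graph_state E \<theta>) (graph_state E \<theta>) = 1"
  unfolding graph_state_eq_diag_mul[OF assms]
  by (simp add: cinner_diag_mul cinner_tensor_vec cinner_ket_angle_self)

text \<open>Edges with both endpoints off \<open>A\<close> cancel in the difference, and by
  independence every other edge has exactly one endpoint in \<open>A\<close>. Grouping by that
  endpoint \<open>k\<close> produces its neighbour sum; the neighbours lie off \<open>A\<close>,
  where \<open>b\<close> and \<open>b'\<close> agree.\<close>

lemma phase_diff:
  assumes G: "weighted_graph E \<theta>" and A: "independent_set E A"
    and b: "\<And>j. j \<notin> A \<Longrightarrow> b j = b' j"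
  shows "phase E \<theta> b - phase E \<theta> b' =
    (\<Sum>k\<in>A. angle E \<theta> k (restrict b (- A)) * (of_bool (b k) - of_bool (b' k)))"
proof -
  define w where "w j k = \<theta> j k * (of_bool (b j \<and> b k) - of_bool (b' j \<and> b' k))" for j k
  have sym: "w j k = w k j" for j k
    using G by (simp add: w_def weighted_graph_def conj_commute)
  \<comment> \<open>Each edge is stored in one orientation only, so splitting \<open>nbrs\<close> by
    orientation counts nothing twice.\<close>
  have asym: "(j, k) \<in> E \<Longrightarrow> (k, j) \<notin> E" for j k
    using G unfolding weighted_graph_def by (metis less_asym)
  define i :: "bool \<Rightarrow> real" where "i = of_bool"
  have "phase E \<theta> b - phase E \<theta> b' = (\<Sum>(j, k)\<in>E. w j k)"
    unfolding phase_def w_def right_diff_distrib sum_subtractf[symmetric]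
    by (intro sum.cong refl) auto
  also have "\<dots> = (\<Sum>(j, k)\<in>UNIV. i ((j, k) \<in> E) * w j k)"
    by (rule sum.mono_neutral_cong_left) (auto simp: i_def)
  also have "\<dots> = (\<Sum>j\<in>UNIV. \<Sum>k\<in>UNIV. i ((j, k) \<in> E) * w j k)"
    by (simp only: UNIV_Times_UNIV[symmetric] sum.cartesian_product)
  also have "\<dots> = (\<Sum>j\<in>UNIV. \<Sum>k\<in>UNIV. i ((j, k) \<in> E \<and> k \<in> A) * w j k + i ((j, k) \<in> E \<and> j \<in> A) * w j k)"
  proof (intro sum.cong refl)
    fix j k
    show "i ((j, k) \<in> E) * w j k = i ((j, k) \<in> E \<and> k \<in> A) * w j k + i ((j, k) \<in> E \<and> j \<in> A) * w j k"
      using A b by (auto simp: i_def independent_set_def w_def)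
  qed
  \<comment> \<open>The names are exchanged in the second sum, so that \<open>k\<close> is the
    endpoint in \<open>A\<close> in both.\<close>
  also have "\<dots> = (\<Sum>k\<in>UNIV. \<Sum>j\<in>UNIV. i ((j, k) \<in> E \<and> k \<in> A) * w j k) +
      (\<Sum>k\<in>UNIV. \<Sum>j\<in>UNIV. i ((k, j) \<in> E \<and> k \<in> A) * w k j)"
    by (simp only: sum.distrib) (subst sum.swap, rule refl)
  also have "\<dots> = (\<Sum>k\<in>UNIV. \<Sum>j\<in>UNIV. i (k \<in> A) * (i (j \<in> nbrs E k) * w j k))"
    unfolding sum.distrib[symmetric]
  proof (intro sum.cong refl)
    fix k j
    show "i ((j, k) \<in> E \<and> k \<in> A) * w j k + i ((k, j) \<in> E \<and> k \<in> A) * w k j =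
        i (k \<in> A) * (i (j \<in> nbrs E k) * w j k)"
      using asym sym[of k j] by (auto simp: i_def nbrs_def)
  qed
  also have "\<dots> = (\<Sum>k\<in>UNIV. i (k \<in> A) * (\<Sum>j\<in>UNIV. i (j \<in> nbrs E k) * w j k))"
    by (simp only: sum_distrib_left)
  also have "\<dots> = (\<Sum>k\<in>A. \<Sum>j\<in>UNIV. i (j \<in> nbrs E k) * w j k)"
    by (rule sum.mono_neutral_cong_right) (auto simp: i_def)
  also have "\<dots> = (\<Sum>k\<in>A. \<Sum>j\<in>nbrs E k. w j k)"
    by (intro sum.cong refl sum.mono_neutral_cong_right) (auto simp: i_def)
  also have "\<dots> = (\<Sum>k\<in>A. angle E \<theta> k (restrict b (- A)) * (of_bool (b k) - of_bool (b' k)))"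
    unfolding angle_def sum_distrib_right
  proof (intro sum.cong refl)
    fix k j assume "k \<in> A" "j \<in> nbrs E k"
    then have "j \<notin> A"
      using A by (auto simp: nbrs_def independent_set_def)
    then show "w j k = \<theta> j k * of_bool (restrict b (- A) j) * (of_bool (b k) - of_bool (b' k))"
      using b[of j] by (cases "b' j") (simp_all add: w_def)
  qed
  finally show ?thesis .
qed

definition exact_proj where
  "exact_proj E \<theta> z k = proj (ket_angle (angle E \<theta> k z))"

definition round_proj where
  "round_proj E \<theta> h z k = proj (ket_angle (round_angle h (angle E \<theta> k z)))"

text \<open>Both sides vanish unless \<open>b\<close> and \<open>b'\<close> agree off
  \<open>A\<close>. There both entries have modulus \<open>(1 / 2) ^ card A\<close>, and
  \<open>phase_diff\<close> matches their phases.\<close>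

lemma controlled_exact_proj:
  assumes G: "weighted_graph E \<theta>" and A: "independent_set E A"
  shows "controlled A (exact_proj E \<theta>) =
    diag_conj (phase_factor E \<theta>) (tensor_op (\<lambda>j. if j \<in> A then proj (ket_angle 0) else mat 1))"
proof -
  let ?T = "tensor_op (\<lambda>j. if j \<in> A then proj (ket_angle 0) else mat 1)"
  have T: "?T $ b $ b' = (if \<forall>j. j \<notin> A \<longrightarrow> b j = b' j then (1 / 2) ^ card A else 0)" for b b'
  proof -
    have "?T $ b $ b' = (\<Prod>j\<in>UNIV. if j \<in> A then 1 / 2 else of_bool (b j = b' j))"
      unfolding tensor_op_def vec_lambda_beta
      by (intro prod.cong) (auto simp: proj_ket_angle_component mat_def)
    also have "\<dots> = (1 / 2) ^ card A * (\<Prod>j\<in>-A. of_bool (b j = b' j))"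
      by (subst prod.If_cases) (auto simp: Compl_eq)
    also have "\<dots> = (if \<forall>j. j \<notin> A \<longrightarrow> b j = b' j then (1 / 2) ^ card A else 0)"
      by (auto intro!: prod_zero)
    finally show ?thesis .
  qed
  have prod_cis: "(\<Prod>k\<in>B. cis (f k) / 2) = (1 / 2) ^ card B * cis (\<Sum>k\<in>B. f k)" for f and B :: "'a set"
    using finite[of B] by (induction B rule: finite_induct) (simp_all flip: cis_mult)
  have "controlled A (exact_proj E \<theta>) $ b $ b' = phase_factor E \<theta> b * ?T $ b $ b' * cnj (phase_factor E \<theta> b')" for b b'
  proof (cases "\<forall>j. j \<notin> A \<longrightarrow> b j = b' j")
    case True
    have "controlled A (exact_proj E \<theta>) $ b $ b' =
        (\<Prod>k\<in>A. cis (angle E \<theta> k (restrict b (- A)) * (of_bool (b k) - of_bool (b' k))) / 2)"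
      by (simp only: controlled_component exact_proj_def proj_ket_angle_component if_P[OF True])
    also have "\<dots> = (1 / 2) ^ card A *
        cis (\<Sum>k\<in>A. angle E \<theta> k (restrict b (- A)) * (of_bool (b k) - of_bool (b' k)))"
      by (rule prod_cis)
    also have "\<dots> = (1 / 2) ^ card A * cis (phase E \<theta> b - phase E \<theta> b')"
      using True by (subst phase_diff[OF G A]) auto
    also have "\<dots> = phase_factor E \<theta> b * ?T $ b $ b' * cnj (phase_factor E \<theta> b')"
      using True unfolding T by (simp add: cis_cnj cis_mult)
    finally show ?thesis .
  next
    case False
    show ?thesis
      by (simp only: controlled_component T if_not_P[OF False]) simp
  qed
  then show ?thesis by (simp add: diag_conj_def vec_eq_iff)
qed

lemma proj_mult_vec: "proj v *v w = cinner v w *s v"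
  by (simp add: cinner_def ketbra_def matrix_vector_mult_def vec_eq_iff sum_distrib_left sum_distrib_right ac_simps)

text \<open>Undoing the phases leaves the product of plus states, which the projectors on
  \<open>A\<close> fix site by site.\<close>

lemma controlled_exact_proj_graph_state:
  assumes G: "weighted_graph E \<theta>" and A: "independent_set E A"
  shows "controlled A (exact_proj E \<theta>) *v graph_state E \<theta> = graph_state E \<theta>"
proof -
  have "(\<lambda>i. (if i \<in> A then proj (ket_angle 0) else mat 1) *v ket_angle 0) = (\<lambda>_. ket_angle 0)"
    by (auto simp: proj_mult_vec cinner_ket_angle_self)
  then show ?thesis
    unfolding controlled_exact_proj[OF assms] graph_state_eq_diag_mul[OF G]
    by (subst diag_conj_mult_diag_mul) (simp_all add: tensor_op_mult_vec)
qed

text \<open>The diagonal phases turn every exact projector into \<open>proj (ket_angle 0)\<close> on \<open>A\<close>, so the claim is a union bound.\<close>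

lemma pos_op_independence_cover:
  assumes G: "weighted_graph E \<theta>" and cover: "independence_cover E \<A>"
  shows "pos_op ((\<Sum>A\<in>\<A>. mat 1 - controlled A (exact_proj E \<theta>)) - (mat 1 - proj (graph_state E \<theta>)))"
proof -
  let ?P = "proj (ket_angle 0)"
  define T where "T A = tensor_op (\<lambda>j. if j \<in> A then ?P else mat 1)" for A :: "'a set"
  define X where "X s = tensor_op (\<lambda>j. if s j then ?P else mat 1 - ?P)" for s :: "'a \<Rightarrow> bool"
  define c where "c A s = (\<Prod>j\<in>UNIV. if s j then 1 else if j \<in> A then 0 else (1::real))"
    for A and s :: "'a \<Rightarrow> bool"
  have X: "pos_op (X s)" for s
    unfolding X_def proj_ket_angle_complement by (intro pos_op_tensor_op) (simp add: pos_op_proj)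
  have T: "T A = (\<Sum>s\<in>UNIV. c A s *\<^sub>R X s)" for A
    unfolding T_def c_def X_def tensor_op_expand[of "\<lambda>_. 1", symmetric]
    by (intro arg_cong[where f = tensor_op] ext) simp
  have 1: "mat 1 = (\<Sum>s\<in>UNIV. 1 *\<^sub>R X s)"
  proof -
    have "c {} s = 1" for s
      unfolding c_def by (intro prod.neutral) simp
    then show ?thesis
      using T[of "{}"] by (simp add: T_def tensor_op_mat_1)
  qed
  have "0 \<le> (\<Sum>A\<in>\<A>. 1 - c A s) - (1 - c UNIV s)" for s
  proof (cases "\<forall>j. s j")
    case True
    then show ?thesis by (simp add: c_def)
  next
    case False
    then obtain j where j: "\<not> s j" by blast
    then obtain A where A: "A \<in> \<A>" "j \<in> A"
      using cover unfolding independence_cover_def by blast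
    have 0: "c B s = 0" if "j \<in> B" for B
      unfolding c_def using j that by (intro prod_zero bexI[of _ j]) auto
    \<comment> \<open>The member of the cover that contains the failing site \<open>j\<close>
      already contributes 1.\<close>
    have "1 - c A s \<le> (\<Sum>A\<in>\<A>. 1 - c A s)"
      using A by (intro member_le_sum) (auto simp: c_def intro!: prod_le_1)
    then show ?thesis using 0[of A] 0[of UNIV] A by simp
  qed
  then have "pos_op (\<Sum>s\<in>UNIV. ((\<Sum>A\<in>\<A>. 1 - c A s) - (1 - c UNIV s)) *\<^sub>R X s)"
    by (intro pos_op_sum pos_op_scaleR X)
  also have "(\<Sum>s\<in>UNIV. ((\<Sum>A\<in>\<A>. 1 - c A s) - (1 - c UNIV s)) *\<^sub>R X s) =
      (\<Sum>A\<in>\<A>. mat 1 - T A) - (mat 1 - T UNIV)"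
  proof -
    have "(\<Sum>A\<in>\<A>. \<Sum>s\<in>UNIV. (1 - c A s) *\<^sub>R X s) = (\<Sum>s\<in>UNIV. (\<Sum>A\<in>\<A>. 1 - c A s) *\<^sub>R X s)"
      unfolding scaleR_sum_left by (rule sum.swap)
    then show ?thesis
      by (simp only: 1 T sum_subtractf[symmetric] scaleR_diff_left[symmetric])
  qed
  finally have "pos_op (diag_conj (phase_factor E \<theta>) ((\<Sum>A\<in>\<A>. mat 1 - T A) - (mat 1 - T UNIV)))"
    by (rule pos_op_diag_conj)
  moreover have "diag_conj (phase_factor E \<theta>) (T A) = controlled A (exact_proj E \<theta>)" if "A \<in> \<A>" for A
    using that cover controlled_exact_proj[OF G] by (simp add: T_def independence_cover_def)
  moreover have "diag_conj (phase_factor E \<theta>) (T UNIV) = proj (graph_state E \<theta>)"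
    by (simp add: graph_state_eq_diag_mul[OF G] proj_diag_mul T_def proj_tensor_vec)
  ultimately show ?thesis
    by (simp add: diag_conj_diff diag_conj_sum diag_conj_mat_1)
qed

subsection \<open>The test operators\<close>

lemma test_Q_controlled:
  assumes "k \<in> A"
  shows "test_Q E \<theta> h A k = controlled A (\<lambda>z. (\<lambda>_. mat 1)(k := round_proj E \<theta> h z k))"
  unfolding test_Q_def controlled_def round_proj_def using assms
  by (intro sum.cong refl arg_cong[where f = tensor_op] ext) auto

lemma test_factor_controlled:
  assumes "k \<in> A" "h \<ge> 1"
  shows "test_factor E \<theta> h A k = controlled A (\<lambda>z. (\<lambda>_. mat 1)(k :=
    (1 / real h) *\<^sub>R round_proj E \<theta> h z k + (1 - 1 / real h) *\<^sub>R mat 1))"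
proof -
  have "(real h - 1) / real h = 1 - 1 / real h"
    using assms(2) by (simp add: field_simps)
  moreover have "(\<lambda>_. mat 1)(k := mat 1) = (\<lambda>_. mat 1 :: bool cmat)"
    by auto
  ultimately show ?thesis
    using assms(1) by (simp add: test_factor_def test_Q_controlled controlled_upd controlled_mat_1)
qed

text \<open>All factors share the control register off \<open>A\<close>, so their product multiplies
  the site operators. The induction grows \<open>B\<close> inside a fixed \<open>A\<close> to keep
  that register unchanged.\<close>

lemma test_P_controlled:
  assumes "h \<ge> 1"
  shows "test_P E \<theta> h A =
    controlled A (\<lambda>z k. (1 / real h) *\<^sub>R round_proj E \<theta> h z k + (1 - 1 / real h) *\<^sub>R mat 1)"
proof -
  define F where "F z k = (1 / real h) *\<^sub>R round_proj E \<theta> h z k + (1 - 1 / real h) *\<^sub>R mat 1" for z k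
  have "op_prod (test_factor E \<theta> h A) B = controlled A (\<lambda>z k. if k \<in> B then F z k else mat 1)" if "B \<subseteq> A" for B
    using finite[of B] that
  proof (induction B rule: finite_induct)
    case empty
    then show ?case by (simp add: op_prod_empty controlled_mat_1)
  next
    case (insert k B)
    have "op_prod (test_factor E \<theta> h A) (insert k B) = test_factor E \<theta> h A k ** op_prod (test_factor E \<theta> h A) B"
      using insert.hyps insert.prems by (intro op_prod_insert test_factor_commute) auto
    also have "\<dots> = controlled A (\<lambda>z. (\<lambda>_. mat 1)(k := F z k)) ** controlled A (\<lambda>z k. if k \<in> B then F z k else mat 1)"
      using insert by (simp only: test_factor_controlled[OF _ assms] F_def insert_subset)
    also have "\<dots> = controlled A (\<lambda>z j. if j \<in> insert k B then F z j else mat 1)"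
      unfolding controlled_mult using insert.hyps by (intro controlled_cong) auto
    finally show ?case .
  qed
  from this[OF order_refl] show ?thesis
    unfolding test_P_def F_def[symmetric] by (auto intro: controlled_cong)
qed

lemma pos_op_round_proj: "pos_op (round_proj E \<theta> h z k)" "pos_op (mat 1 - round_proj E \<theta> h z k)"
  by (simp_all add: round_proj_def proj_ket_angle_complement pos_op_proj)

lemma pos_op_exact_proj: "pos_op (exact_proj E \<theta> z k)" "pos_op (mat 1 - exact_proj E \<theta> z k)"
  by (simp_all add: exact_proj_def proj_ket_angle_complement pos_op_proj)

lemma pos_op_test_P:
  assumes "h \<ge> 1"
  shows "pos_op (test_P E \<theta> h A)" "pos_op (mat 1 - test_P E \<theta> h A)"
proof -
  have p: "0 \<le> 1 / real h" "1 / real h \<le> 1" using assms by auto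
  have pos: "pos_op ((1 / real h) *\<^sub>R round_proj E \<theta> h z k + (1 - 1 / real h) *\<^sub>R mat 1)" for z k
    using p by (intro pos_op_add pos_op_scaleR pos_op_round_proj pos_op_mat_1) auto
  then show "pos_op (test_P E \<theta> h A)"
    unfolding test_P_controlled[OF assms] by (intro pos_op_controlled)
  \<comment> \<open>Sitewise the complement is a nonnegative multiple of the complementary
    projector, so each site operator lies below the identity.\<close>
  have "mat 1 - ((1 / real h) *\<^sub>R round_proj E \<theta> h z k + (1 - 1 / real h) *\<^sub>R mat 1) =
      (1 / real h) *\<^sub>R (mat 1 - round_proj E \<theta> h z k)" for z k
    by (simp add: algebra_simps)
  then show "pos_op (mat 1 - test_P E \<theta> h A)"
    unfolding test_P_controlled[OF assms] controlled_mat_1[of A, symmetric] using p pos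
    by (intro pos_op_controlled_mono) (simp_all only: pos_op_scaleR pos_op_round_proj)
qed

section \<open>Expectations of the test operators in the graph state\<close>

lemma cinner_mono:
  assumes "pos_op (M' - M)"
  shows "Re (cinner v (M *v v)) \<le> Re (cinner v (M' *v v))"
proof -
  have "cinner v ((M' - M) *v v) = cinner v (M' *v v) - cinner v (M *v v)"
    by (simp add: matrix_vector_mult_diff_rdistrib cinner_def right_diff_distrib sum_subtractf)
  then show ?thesis using cinner_pos_op(2)[OF assms, of v] by simp
qed

lemma scaleR_mult_vec: "(r *\<^sub>R M) *v v = r *\<^sub>R (M *v v)"
  for M :: "'b::finite cmat"
  by (simp add: matrix_vector_mult_def vec_eq_iff scaleR_sum_right)

lemma cinner_scaleR: "cinner v (r *\<^sub>R w) = r *\<^sub>R cinner v w"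
  by (simp add: cinner_def scaleR_sum_right)

lemma cinner_sum: "cinner v (\<Sum>x\<in>S. f x) = (\<Sum>x\<in>S. cinner v (f x))"
  by (simp add: cinner_def sum_distrib_left sum.swap[of _ UNIV S])

lemma sum_mult_vec: "(\<Sum>x\<in>S. f x) *v v = (\<Sum>x\<in>S. f x *v v)"
  for f :: "'x \<Rightarrow> 'b::finite cmat"
  by (induction S rule: infinite_finite_induct) (simp_all add: matrix_vector_mult_add_rdistrib)

text \<open>
  The state is fixed by the exact projector \<open>S\<close>, so \<open>P\<close> may be replaced by \<open>S P S\<close>; sitewise this
  compresses the rounded projector to a multiple of the exact one.
\<close>

lemma cinner_test_P_ge:
  assumes G: "weighted_graph E \<theta>" and A: "independent_set E A" and h: "h \<ge> 1"
  shows "(1 - (1 / real h) * (sin (pi / (4 * real h)))\<^sup>2) ^ card A \<le>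
    Re (cinner (graph_state E \<theta>) (test_P E \<theta> h A *v graph_state E \<theta>))"
proof -
  define p where "p = 1 / real h"
  have p: "0 \<le> p" "p \<le> 1" using h by (auto simp: p_def)
  \<comment> \<open>\<open>c\<close> is \<open>p * (1 - s) + (1 - p)\<close> with \<open>s\<close>
    replaced by its upper bound, where \<open>s\<close> is the squared sine of half the rounding
    error.\<close>
  define c where "c = 1 - p * (sin (pi / (4 * real h)))\<^sup>2"
  have c: "0 \<le> c"
    using p by (simp add: c_def abs_square_le_1 mult_le_one)
  define S where "S = controlled A (exact_proj E \<theta>)"
  let ?G = "graph_state E \<theta>" and ?P = "test_P E \<theta> h A"
  have SG: "S *v ?G = ?G"
    unfolding S_def by (rule controlled_exact_proj_graph_state[OF G A])
  have S: "pos_op S"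
    unfolding S_def by (intro pos_op_controlled pos_op_exact_proj)
  define K where "K z k = exact_proj E \<theta> z k ** (p *\<^sub>R round_proj E \<theta> h z k + (1 - p) *\<^sub>R mat 1) ** exact_proj E \<theta> z k" for z k
  have K: "pos_op (K z k - c *\<^sub>R exact_proj E \<theta> z k)" for z k
  proof -
    \<comment> \<open>\<open>1 - s\<close> is the squared overlap of the exact and the rounded angle
      state, which is the factor produced by \<open>proj_sandwich\<close>.\<close>
    define s where "s = (sin ((angle E \<theta> k z - round_angle h (angle E \<theta> k z)) / 2))\<^sup>2"
    have "s = (sin ((round_angle h (angle E \<theta> k z) - angle E \<theta> k z) / 2))\<^sup>2"
      unfolding s_def by (metis minus_diff_eq minus_divide_left power2_minus sin_minus)
    also have "\<dots> \<le> (sin (pi / (4 * real h)))\<^sup>2"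
      using sin_round_angle_bound[OF h] by (rule abs_le_square_iff[THEN iffD1, OF order_trans[OF _ abs_ge_self]])
    finally have s: "s \<le> (sin (pi / (4 * real h)))\<^sup>2" .
    have "exact_proj E \<theta> z k ** exact_proj E \<theta> z k = exact_proj E \<theta> z k"
      by (simp add: exact_proj_def ketbra_mult cinner_ket_angle_self)
    then have "K z k = p *\<^sub>R (1 - s) *\<^sub>R exact_proj E \<theta> z k + (1 - p) *\<^sub>R exact_proj E \<theta> z k"
      using proj_sandwich[of "ket_angle (angle E \<theta> k z)" "ket_angle (round_angle h (angle E \<theta> k z))"]
      unfolding cmod_cinner_ket_angle s_def[symmetric] exact_proj_def[symmetric] round_proj_def[symmetric]
      by (simp add: K_def matrix_mult_add scaleR_matrix_mult)
    then have "K z k - c *\<^sub>R exact_proj E \<theta> z k = (p * ((sin (pi / (4 * real h)))\<^sup>2 - s)) *\<^sub>R exact_proj E \<theta> z k"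
      by (simp add: c_def algebra_simps)
    then show ?thesis
      using p s by (simp add: pos_op_scaleR pos_op_exact_proj)
  qed
  have "pos_op (S ** ?P ** S - c ^ card A *\<^sub>R S)"
  proof -
    have "c ^ card A *\<^sub>R S = controlled A (\<lambda>z k. c *\<^sub>R exact_proj E \<theta> z k)"
      by (simp add: controlled_scaleR S_def)
    moreover have "S ** ?P ** S = controlled A K"
      by (simp add: S_def test_P_controlled[OF h] controlled_mult K_def[abs_def] p_def)
    ultimately show ?thesis
      using c K by (simp add: pos_op_controlled_mono pos_op_scaleR pos_op_exact_proj)
  qed
  from cinner_mono[OF this, of ?G]
  have "c ^ card A * Re (cinner ?G (S *v ?G)) \<le> Re (cinner ?G ((S ** ?P ** S) *v ?G))"
    by (simp add: scaleR_mult_vec cinner_scaleR)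
  also have "cinner ?G ((S ** ?P ** S) *v ?G) = cinner ?G (S *v (?P *v (S *v ?G)))"
    by (simp only: matrix_vector_mul_assoc matrix_mul_assoc)
  also have "\<dots> = cinner ?G (?P *v ?G)"
    unfolding cinner_pos_op_left[OF S, symmetric] SG ..
  finally show ?thesis
    by (simp add: SG cinner_graph_state[OF G] c_def p_def)
qed

section \<open>Passing probability and resultant state\<close>

lemma pass_prob_product_state:
  assumes "pos_op \<Omega>" "cinner v v = 1" "CARD('c::finite) = N + 1"
  shows "pass_prob \<Omega> (proj (tensor_vec (\<lambda>_::'c. v))) = Re (cinner v (\<Omega> *v v)) ^ N"
proof -
  define r where "r = Re (cinner v (\<Omega> *v v))"
  have r: "cinner v (\<Omega> *v v) = complex_of_real r"
    unfolding r_def by (rule cinner_pos_op(1)[OF assms(1)])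
  have "trace (tested_except \<Omega> i ** proj (tensor_vec (\<lambda>_::'c. v))) = complex_of_real (r ^ N)" for i
  proof -
    have "trace (tested_except \<Omega> i ** proj (tensor_vec (\<lambda>_::'c. v))) =
        (\<Prod>j\<in>UNIV. cinner v (((\<lambda>_. \<Omega>)(i := mat 1)) j *v v))"
      by (simp only: trace_mult_proj tested_except_def tensor_op_mult_vec cinner_tensor_vec)
    \<comment> \<open>The omitted copy contributes 1 by normalization and each of the other
      \<open>N\<close> copies contributes \<open>r\<close>, whichever \<open>i\<close> is left
      out.\<close>
    also have "\<dots> = (\<Prod>j\<in>UNIV - {i}. complex_of_real r)"
      by (simp add: prod.remove[of UNIV i] assms(2) r)
    finally show ?thesis by (simp add: assms(3))
  qed
  then show ?thesis
    using assms(3) by (simp add: pass_prob_def r_def flip: of_real_power)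
qed

lemma tested_except_op_at:
  "tested_except \<Omega> i ** op_at i X = tensor_op ((\<lambda>_. \<Omega>)(i := X))"
  unfolding tested_except_def op_at_def tensor_op_mult
  by (intro arg_cong[where f = tensor_op] ext) simp

text \<open>\<open>X\<close> on the untested copy and \<open>\<Omega>\<close> on the others form one
  positive tensor product; the positive passing probability gives the normalization the right
  sign.\<close>

lemma resultant_state_pos:
  fixes \<rho> :: "('c::finite \<Rightarrow> 'b::finite) cmat"
  assumes "resultant_state \<Omega> \<rho> \<sigma>" "density_op \<rho>" "0 < pass_prob \<Omega> \<rho>" "pos_op \<Omega>" "pos_op X"
  shows "0 \<le> Re (trace (\<sigma> ** X))"
proof -
  have "0 \<le> Re (trace (tested_except \<Omega> i ** op_at i X ** \<rho>))" for i
    unfolding tested_except_op_at using assms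
    by (intro trace_pos_op_nonneg pos_op_tensor_op) (auto simp: density_op_def)
  then show ?thesis
    using assms(1,3) unfolding resultant_state_def
    by (simp add: sum_nonneg del: of_real_divide of_real_mult)
qed

text \<open>Let \<open>p\<close> be the passing probability and \<open>q\<close> the probability
  that all \<open>N + 1\<close> copies pass. Then the expectation of \<open>\<Omega>\<close> in
  \<open>\<sigma>\<close> is \<open>q / p\<close>, and \<open>pos_op_random_sampling\<close> gives
  \<open>(N + 1) * p \<le> 1 + N * q\<close>. Hence
  \<open>1 - q / p \<le> (1 - p) / (p * N)\<close>, which decreases in \<open>p\<close>, so
  \<open>\<beta>\<close> may replace \<open>p\<close>.\<close>

lemma resultant_state_expectation:
  fixes \<rho> :: "('c::finite \<Rightarrow> 'b::finite) cmat"
  assumes "resultant_state \<Omega> \<rho> \<sigma>" "density_op \<rho>" "pos_op \<Omega>" "pos_op (mat 1 - \<Omega>)"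
    and \<beta>: "0 < \<beta>" "\<beta> \<le> pass_prob \<Omega> \<rho>" and N: "CARD('c) = N + 1" "N \<ge> 1"
  shows "Re (trace (\<sigma> ** mat 1)) = 1"
    and "1 - Re (trace (\<sigma> ** \<Omega>)) \<le> (1 - \<beta>) / (\<beta> * real N)"
proof -
  define p where "p = pass_prob \<Omega> \<rho>"
  have p: "0 < p" "\<beta> \<le> p" using \<beta> by (auto simp: p_def)
  define q where "q = Re (trace (tensor_op (\<lambda>_::'c. \<Omega>) ** \<rho>))"
  have "Re (trace (\<sigma> ** X)) = 1 / (p * (real N + 1)) *
      (\<Sum>i\<in>UNIV. Re (trace (tested_except \<Omega> i ** op_at i X ** \<rho>)))" for X
    using assms(1) unfolding resultant_state_def
    by (simp add: p_def N(1) add.commute del: of_real_divide of_real_mult)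
  note \<sigma> = this[unfolded tested_except_op_at]
  have sum: "(\<Sum>i\<in>UNIV. Re (trace (tested_except \<Omega> i ** \<rho>))) = p * (real N + 1)"
    by (simp add: p_def pass_prob_def N(1) add.commute)
  \<comment> \<open>Measuring \<open>\<Omega>\<close> on the remaining copy fills the gap at
    \<open>i\<close>, so all \<open>N + 1\<close> terms equal \<open>q\<close>.\<close>
  have "(\<lambda>_::'c. \<Omega>)(i := \<Omega>) = (\<lambda>_. \<Omega>)" for i by auto
  then have \<Omega>: "Re (trace (\<sigma> ** \<Omega>)) = q / p"
    unfolding \<sigma> by (simp add: q_def[symmetric] N(1) add.commute)
  show "Re (trace (\<sigma> ** mat 1)) = 1"
    using sum p(1) unfolding \<sigma> tested_except_def by simp
  have "0 \<le> Re (trace ((mat 1 + (real CARD('c) - 1) *\<^sub>R tensor_op (\<lambda>_::'c. \<Omega>) -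
    (\<Sum>i\<in>UNIV. tested_except \<Omega> (i::'c))) ** \<rho>))"
    using assms(2) by (intro trace_pos_op_nonneg pos_op_random_sampling assms) (auto simp: density_op_def)
  also have "\<dots> = 1 + real N * q - p * (real N + 1)"
  proof -
    have tr: "trace (A - B) = trace A - trace B" "trace (A + B) = trace A + trace B"
      "trace (r *\<^sub>R A) = r *\<^sub>R trace A" for A B :: "('c \<Rightarrow> 'b) cmat" and r
      by (simp_all add: trace_def sum_subtractf sum.distrib scaleR_sum_right)
    have "(A - B) ** \<rho> = A ** \<rho> - B ** \<rho>" for A B :: "('c \<Rightarrow> 'b) cmat"
      using matrix_mult_add(1)[of "A - B" B \<rho>] by simp
    then show ?thesis
      using assms(2)
      by (simp add: tr matrix_mult_add scaleR_matrix_mult matrix_mult_sum trace_sum N(1) q_def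
          sum density_op_def)
  qed
  finally have "real N * (p - q) \<le> 1 - p"
    by (simp add: algebra_simps)
  then have "real N * (p - q) / (p * real N) \<le> (1 - p) / (p * real N)"
    using p(1) by (intro divide_right_mono) auto
  moreover have "real N * (p - q) / (p * real N) = 1 - q / p"
    using p(1) N(2) by (simp add: field_simps)
  ultimately have "1 - q / p \<le> (1 - p) / (p * real N)"
    by simp
  also have "\<dots> = (1 / p - 1) / real N"
    using p(1) by (simp add: field_simps)
  also have "\<dots> \<le> (1 / \<beta> - 1) / real N"
    using p \<beta>(1) by (intro divide_right_mono diff_right_mono divide_left_mono) auto
  also have "\<dots> = (1 - \<beta>) / (\<beta> * real N)"
    using \<beta>(1) by (simp add: field_simps)
  finally show "1 - Re (trace (\<sigma> ** \<Omega>)) \<le> (1 - \<beta>) / (\<beta> * real N)"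
    by (simp add: \<Omega>)
qed

section \<open>The two bounds for the random sampling test\<close>

theorem theorem4:
  fixes E :: "('v::{finite,linorder} \<times> 'v) set"
    and \<theta> :: "'v \<Rightarrow> 'v \<Rightarrow> real"
    and \<A> :: "'v set set"
    and n m h N :: nat
    and \<beta> :: real
  assumes "weighted_graph E \<theta>" and "CARD('v) = n"
    and "independence_cover E \<A>" and "card \<A> = m"
    and "h \<ge> 1" and "N \<ge> 1" and "CARD('c::finite) = N + 1"
    and "0 < \<beta>" and "\<beta> \<le> 1" and "\<beta> \<ge> 1 / (real N + 1)"
  shows
    "pass_prob (test_Omega E \<theta> h \<A>) (proj (tensor_vec (\<lambda>_::'c. graph_state E \<theta>)))
       \<ge> (1 - (1 / real h) * (sin (pi / (4 * real h)))\<^sup>2) ^ (N * Max (card ` \<A>)) \<and>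
     (\<forall>(\<rho> :: ('c \<Rightarrow> 'v \<Rightarrow> bool) cmat) \<sigma>.
        density_op \<rho> \<longrightarrow> pass_prob (test_Omega E \<theta> h \<A>) \<rho> \<ge> \<beta> \<longrightarrow>
        resultant_state (test_Omega E \<theta> h \<A>) \<rho> \<sigma> \<longrightarrow>
        Re (cinner (graph_state E \<theta>) (\<sigma> *v graph_state E \<theta>))
          \<ge> 1 - (real m * real h * (1 - \<beta>) / (\<beta> * real N) + real n * sin (pi / (4 * real h))))"
proof (intro conjI allI impI)
  note G = assms(1) and cover = assms(3) and h = assms(5)
  let ?G = "graph_state E \<theta>" and ?\<Omega> = "test_Omega E \<theta> h \<A>" and ?P = "test_P E \<theta> h"
  define e where "e = sin (pi / (4 * real h))"
  have ind: "independent_set E A" if "A \<in> \<A>" for A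
    using cover that by (simp add: independence_cover_def)
  have "\<A> \<noteq> {}"
    using cover by (auto simp: independence_cover_def)
  then have m: "m > 0"
    using assms(4) by (simp add: card_gt_0_iff flip: assms(4))
  have \<Omega>: "pos_op ?\<Omega>"
    unfolding test_Omega_def by (intro pos_op_scaleR pos_op_sum pos_op_test_P h) simp
  have "mat 1 - ?\<Omega> = (1 / real m) *\<^sub>R (\<Sum>A\<in>\<A>. mat 1 - ?P A)"
  proof -
    have "(\<Sum>A\<in>\<A>. mat 1) = real m *\<^sub>R (mat 1 :: ('v \<Rightarrow> bool) cmat)"
      by (simp only: sum_constant_scaleR assms(4))
    then show ?thesis
      unfolding sum_subtractf using m by (simp add: test_Omega_def assms(4) scaleR_diff_right)
  qed
  also have "pos_op \<dots>"
    by (intro pos_op_scaleR pos_op_sum pos_op_test_P h) simp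
  finally have \<Omega>': "pos_op (mat 1 - ?\<Omega>)" .
  {
    define c where "c = 1 - (1 / real h) * e\<^sup>2"
    have "(1 / real h) * e\<^sup>2 \<le> 1"
      using h by (intro mult_le_one) (auto simp: e_def abs_square_le_1)
    then have c: "0 \<le> c" "c \<le> 1"
      by (simp_all add: c_def)
    \<comment> \<open>Since \<open>c\<close> lies between 0 and 1, the largest set of the cover
      gives the weakest bound, which serves for all.\<close>
    have "c ^ Max (card ` \<A>) \<le> Re (cinner ?G (?P A *v ?G))" if "A \<in> \<A>" for A
    proof -
      have "c ^ Max (card ` \<A>) \<le> c ^ card A"
        using that c by (intro power_decreasing) auto
      also have "\<dots> \<le> Re (cinner ?G (?P A *v ?G))"
        unfolding c_def e_def by (rule cinner_test_P_ge[OF G ind[OF that] h])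
      finally show ?thesis .
    qed
    then have "real m * c ^ Max (card ` \<A>) \<le> (\<Sum>A\<in>\<A>. Re (cinner ?G (?P A *v ?G)))"
      using sum_bounded_below[of \<A> "c ^ Max (card ` \<A>)"] by (simp add: assms(4))
    also have "\<dots> = real m * Re (cinner ?G (?\<Omega> *v ?G))"
      using m by (simp add: test_Omega_def scaleR_mult_vec cinner_scaleR sum_mult_vec cinner_sum assms(4))
    finally have "c ^ Max (card ` \<A>) \<le> Re (cinner ?G (?\<Omega> *v ?G))"
      using m by simp
    then have "(c ^ Max (card ` \<A>)) ^ N \<le> Re (cinner ?G (?\<Omega> *v ?G)) ^ N"
      using c by (intro power_mono) auto
    then have "c ^ (N * Max (card ` \<A>)) \<le> Re (cinner ?G (?\<Omega> *v ?G)) ^ N"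
      by (simp add: power_mult[symmetric] mult.commute)
    then show "pass_prob ?\<Omega> (proj (tensor_vec (\<lambda>_::'c. ?G)))
       \<ge> (1 - (1 / real h) * (sin (pi / (4 * real h)))\<^sup>2) ^ (N * Max (card ` \<A>))"
      unfolding pass_prob_product_state[OF \<Omega> cinner_graph_state[OF G] assms(7)] c_def e_def .
  }
  fix \<rho> :: "('c \<Rightarrow> 'v \<Rightarrow> bool) cmat" and \<sigma>
  assume \<rho>: "density_op \<rho>" "pass_prob ?\<Omega> \<rho> \<ge> \<beta>" "resultant_state ?\<Omega> \<rho> \<sigma>"
  \<comment> \<open>\<open>g\<close> is the expectation in \<open>\<sigma>\<close>: linear,
    nonnegative on \<open>pos_op\<close> and 1 at the identity, so operator inequalities pass to
    numbers.\<close>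
  define g where "g X = Re (trace (\<sigma> ** X))" for X
  have g_add: "g (X + Y) = g X + g Y" and g_scaleR: "g (r *\<^sub>R X) = r * g X" for X Y r
    by (simp_all add: g_def matrix_mult_add scaleR_matrix_mult)
       (simp_all add: trace_def sum.distrib scaleR_sum_right[symmetric])
  have g_diff: "g (X - Y) = g X - g Y" for X Y
    using g_add[of "X - Y" Y] by simp
  have g_sum: "g (\<Sum>x\<in>S. f x) = (\<Sum>x\<in>S. g (f x))" for f and S :: "'v set set"
    by (simp add: g_def matrix_mult_sum trace_sum)
  have g_pos: "0 \<le> g X" if "pos_op X" for X
    unfolding g_def using \<rho> assms(8) that by (intro resultant_state_pos[OF \<rho>(3,1) _ \<Omega>]) auto
  note fid = resultant_state_expectation[OF \<rho>(3,1) \<Omega> \<Omega>' assms(8) \<rho>(2) assms(7,6), folded g_def]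
  have e: "0 \<le> e"
    unfolding e_def using h by (intro sin_ge_zero) (auto simp: field_simps)
  have single: "g (mat 1 - controlled A (exact_proj E \<theta>)) \<le> real h * (1 - g (?P A)) + real (card A) * e"
    if "A \<in> \<A>" for A
  proof -
    define R where "R = controlled A (round_proj E \<theta> h)"
    define S where "S = controlled A (exact_proj E \<theta>)"
    define p where "p = 1 / real h"
    have p: "0 \<le> p" "p \<le> 1" "real h * p = 1" using h by (auto simp: p_def)
    \<comment> \<open>Multiplied by \<open>real h\<close>, the inverse of \<open>p\<close>, this
      bounds \<open>1 - g R\<close> by \<open>real h * (1 - g (?P A))\<close>.\<close>
    have "pos_op ((1 - p) *\<^sub>R mat 1 + p *\<^sub>R R - ?P A)"
      unfolding test_P_controlled[OF h] R_def p_def[symmetric]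
      by (intro pos_op_controlled_weaken pos_op_round_proj p)
    from g_pos[OF this] have "g (?P A) \<le> (1 - p) + p * g R"
      by (simp add: g_add g_diff g_scaleR fid)
    then have "real h * g (?P A) \<le> real h * ((1 - p) + p * g R)"
      by (intro mult_left_mono) auto
    also have "\<dots> = real h - real h * p + (real h * p) * g R"
      by (simp add: algebra_simps)
    finally have R: "1 - g R \<le> real h * (1 - g (?P A))"
      unfolding p(3) by (simp add: algebra_simps)
    have "pos_op ((real (card A) * e) *\<^sub>R mat 1 - (R - S))"
      unfolding R_def S_def
    proof (intro pos_op_controlled_telescope pos_op_round_proj pos_op_exact_proj e)
      show "pos_op (e *\<^sub>R mat 1 - (round_proj E \<theta> h z k - exact_proj E \<theta> z k))" for z k
        unfolding round_proj_def exact_proj_def e_def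
        by (intro pos_op_ket_angle_diff sin_round_angle_bound h)
    qed
    from g_pos[OF this] have "g R - g S \<le> real (card A) * e"
      by (simp add: g_diff g_scaleR fid)
    then show ?thesis
      using R by (simp add: g_diff fid S_def)
  qed
  have "g (mat 1 - proj ?G) \<le> (\<Sum>A\<in>\<A>. g (mat 1 - controlled A (exact_proj E \<theta>)))"
    using g_pos[OF pos_op_independence_cover[OF G cover]] by (simp add: g_diff g_sum)
  also have "\<dots> \<le> (\<Sum>A\<in>\<A>. real h * (1 - g (?P A)) + real (card A) * e)"
    by (intro sum_mono single)
  also have "\<dots> = real h * (real m - (\<Sum>A\<in>\<A>. g (?P A))) + (\<Sum>A\<in>\<A>. real (card A)) * e"
    by (simp add: sum.distrib sum_subtractf sum_distrib_right assms(4) flip: sum_distrib_left)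
  \<comment> \<open>Disjointness of the cover makes the numbers of exchanged sites add up to
    \<open>n\<close>.\<close>
  also have "(\<Sum>A\<in>\<A>. real (card A)) = real n"
  proof -
    have "card (\<Union>\<A>) = (\<Sum>A\<in>\<A>. card A)"
      using cover by (intro card_Union_disjoint) (auto simp: independence_cover_def)
    then show ?thesis
      using cover by (simp add: independence_cover_def assms(2) flip: of_nat_sum)
  qed
  also have "(\<Sum>A\<in>\<A>. g (?P A)) = real m * g ?\<Omega>"
    using m by (simp add: test_Omega_def g_scaleR g_sum assms(4))
  also have "real h * (real m - real m * g ?\<Omega>) = real m * real h * (1 - g ?\<Omega>)"
    by (simp add: algebra_simps)
  also have "\<dots> \<le> real m * real h * ((1 - \<beta>) / (\<beta> * real N))"
    using fid(2) by (intro mult_left_mono) auto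
  finally have "1 - g (proj ?G) \<le> real m * real h * (1 - \<beta>) / (\<beta> * real N) + real n * e"
    by (simp add: g_diff fid)
  then show "Re (cinner ?G (\<sigma> *v ?G))
      \<ge> 1 - (real m * real h * (1 - \<beta>) / (\<beta> * real N) + real n * sin (pi / (4 * real h)))"
    unfolding g_def trace_mult_proj e_def by linarith
qed

end
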